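(* (1) The Pixley–Roy space is a Tychonoff space with a uniform base which is not an E-space. (2) Under MA$+\neg$CH, there exists a normal Hausdorff space with a uniform base which is not an E-space. (3) Under PMEA, every normal $T_1$-space with a uniform base is an E-space.
   Context: "Space" means topological $T_0$-space. $\mathbb N=\{1,2,\dots\}$. For a space $X$, a zero-set is $f^{-1}(0)$ and a cozero-set is $X\setminus f^{-1}(0)$ for a continuous $f:X\to[0,1]$; $Z(X)$ and $Coz(X)$ are the collections of all zero-sets and all cozero-sets. A U-representation of a subset $V$ of a space $X$ is a collection $U(V)=\{U_k(V): k\in\mathbb N\}$ with $V=\bigcup_k U_k(V)$ and, for all $k\in\mathbb N$, $U_k(V)\subseteq U_{k+1}(V)$, $U_{2k-1}(V)\in Z(X)$, $U_{2k}(V)\in Coz(X)$. A family $\alpha$ of subsets of $X$ is an almost subbase of $X$ if one can choose for each $V\in\alpha$ a U-representation $U(V)$ such that $\alpha\cup\{X\setminus U_{2k-1}(V): V\in\alpha, k\in\mathbb N\}$ is a subbase of $X$. A family of subsets of a set is strongly point-finite if every subfamily of cardinality $\aleph_0$ contains a finite subfamily with empty intersection; it is $\sigma$-strongly point-finite if it is a union of countably many strongly point-finite families. $X$ is an E-space if it has a $\sigma$-strongly point-finite almost subbase. A base $\mathcal B$ of a space $X$ is uniform (in the sense of P. S. Alexandrov) if for every $x\in X$, every infinite subfamily of $\mathcal B$ all of whose members contain $x$ is a base at $x$. (A regular space has a uniform base iff it is a metacompact Moore space.) The Pixley–Roy space has as points the non-empty finite subsets of $\mathbb R$; basic open sets are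 $[F,U]=\{G: F\subseteq G\subseteq U\}$ (with $G$ ranging over non-empty finite subsets of $\mathbb R$), where $F$ is a non-empty finite subset of $\mathbb R$ and $U\supseteq F$ is open in $\mathbb R$. It is a non-separable metacompact Moore space in which every disjoint family of open sets is countable. MA is Martin's Axiom, CH the Continuum Hypothesis. PMEA (Product Measure Extension Axiom): for every cardinal $\kappa$, the usual product measure on $\{0,1\}^\kappa$ extends to a $2^{\aleph_0}$-additive measure defined on all subsets of $\{0,1\}^\kappa$. *)

theory Defs
  imports "HOL-Analysis.Analysis" "HOL-Library.Equipollence"
begin

section \<open>Zero-sets, cozero-sets and E-spaces\<close>

definition zero_set_in :: "'a topology \<Rightarrow> 'a set \<Rightarrow> bool" where
  "zero_set_in X Z \<longleftrightarrow>
     (\<exists>f. continuous_map X (top_of_set {0..1::real}) f \<and> Z = {x \<in> topspace X. f x = 0})"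

definition cozero_set_in :: "'a topology \<Rightarrow> 'a set \<Rightarrow> bool" where
  "cozero_set_in X C \<longleftrightarrow>
     (\<exists>f. continuous_map X (top_of_set {0..1::real}) f \<and> C = topspace X - {x \<in> topspace X. f x = 0})"

text \<open>Sequences are indexed by the positive integers; the value at \<open>0\<close> is irrelevant.\<close>

definition U_representation :: "'a topology \<Rightarrow> 'a set \<Rightarrow> (nat \<Rightarrow> 'a set) \<Rightarrow> bool" where
  "U_representation X V U \<longleftrightarrow>
     V = (\<Union>k\<in>{1..}. U k) \<and>
     (\<forall>k\<ge>1. U k \<subseteq> U (k + 1) \<and> zero_set_in X (U (2 * k - 1)) \<and> cozero_set_in X (U (2 * k)))"

text \<open>The finite intersections of members of a subbase form a base; the empty intersection is the
  whole space.\<close>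

definition subbase_in :: "'a topology \<Rightarrow> 'a set set \<Rightarrow> bool" where
  "subbase_in X \<S> \<longleftrightarrow>
     \<S> \<subseteq> Pow (topspace X) \<and>
     openin X = arbitrary union_of (finite intersection_of (\<lambda>S. S \<in> \<S>) relative_to topspace X)"

definition almost_subbase_in :: "'a topology \<Rightarrow> 'a set set \<Rightarrow> bool" where
  "almost_subbase_in X \<alpha> \<longleftrightarrow>
     (\<exists>U. (\<forall>V\<in>\<alpha>. U_representation X V (U V)) \<and>
          subbase_in X (\<alpha> \<union> {topspace X - U V (2 * k - 1) | V k. V \<in> \<alpha> \<and> k \<ge> 1}))"

definition strongly_point_finite :: "'a set set \<Rightarrow> bool" where
  "strongly_point_finite \<alpha> \<longleftrightarrow>
     (\<forall>\<beta>\<subseteq>\<alpha>. countable \<beta> \<and> infinite \<beta> \<longrightarrow> (\<exists>\<gamma>\<subseteq>\<beta>. finite \<gamma> \<and> \<gamma> \<noteq> {} \<and> \<Inter>\<gamma> = {}))"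

definition sigma_strongly_point_finite :: "'a set set \<Rightarrow> bool" where
  "sigma_strongly_point_finite \<alpha> \<longleftrightarrow>
     (\<exists>A :: nat \<Rightarrow> 'a set set. \<alpha> = (\<Union>n. A n) \<and> (\<forall>n. strongly_point_finite (A n)))"

definition E_space :: "'a topology \<Rightarrow> bool" where
  "E_space X \<longleftrightarrow>
     t0_space X \<and> (\<exists>\<alpha>. almost_subbase_in X \<alpha> \<and> sigma_strongly_point_finite \<alpha>)"


section \<open>Uniform bases\<close>

definition base_in :: "'a topology \<Rightarrow> 'a set set \<Rightarrow> bool" where
  "base_in X \<B> \<longleftrightarrow> openin X = arbitrary union_of (\<lambda>B. B \<in> \<B>)"

definition base_at :: "'a topology \<Rightarrow> 'a \<Rightarrow> 'a set set \<Rightarrow> bool" where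
  "base_at X x \<C> \<longleftrightarrow>
     (\<forall>C\<in>\<C>. openin X C \<and> x \<in> C) \<and>
     (\<forall>W. openin X W \<and> x \<in> W \<longrightarrow> (\<exists>C\<in>\<C>. C \<subseteq> W))"

definition uniform_base_in :: "'a topology \<Rightarrow> 'a set set \<Rightarrow> bool" where
  "uniform_base_in X \<B> \<longleftrightarrow>
     base_in X \<B> \<and>
     (\<forall>x\<in>topspace X. \<forall>\<C>\<subseteq>\<B>. infinite \<C> \<and> (\<forall>C\<in>\<C>. x \<in> C) \<longrightarrow> base_at X x \<C>)"

definition has_uniform_base :: "'a topology \<Rightarrow> bool" where
  "has_uniform_base X \<longleftrightarrow> (\<exists>\<B>. uniform_base_in X \<B>)"

definition Tychonoff_space :: "'a topology \<Rightarrow> bool" where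
  "Tychonoff_space X \<longleftrightarrow> completely_regular_space X \<and> t1_space X"


section \<open>The Pixley--Roy space\<close>

definition pixley_roy_basic :: "real set \<Rightarrow> real set \<Rightarrow> real set set" where
  "pixley_roy_basic F U = {G. finite G \<and> G \<noteq> {} \<and> F \<subseteq> G \<and> G \<subseteq> U}"

definition pixley_roy_base :: "real set set set" where
  "pixley_roy_base = {pixley_roy_basic F U | F U. finite F \<and> F \<noteq> {} \<and> open U \<and> F \<subseteq> U}"

definition pixley_roy :: "real set topology" where
  "pixley_roy = topology (arbitrary union_of (\<lambda>B. B \<in> pixley_roy_base))"

lemma pixley_roy_basic_Int:
  "pixley_roy_basic F U \<inter> pixley_roy_basic G V = pixley_roy_basic (F \<union> G) (U \<inter> V)"
  by (auto simp: pixley_roy_basic_def)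

lemma base_in_pixley_roy: "base_in pixley_roy pixley_roy_base"
proof -
  have "(arbitrary union_of (\<lambda>B. B \<in> pixley_roy_base)) (S \<inter> T)"
    if S: "S \<in> pixley_roy_base" and T: "T \<in> pixley_roy_base" for S T
  proof -
    obtain F U where F: "S = pixley_roy_basic F U" "finite F" "F \<noteq> {}" "open U"
      using S by (auto simp: pixley_roy_base_def)
    obtain G V where G: "T = pixley_roy_basic G V" "finite G" "open V"
      using T by (auto simp: pixley_roy_base_def)
    have eq: "S \<inter> T = pixley_roy_basic (F \<union> G) (U \<inter> V)"
      using F G by (simp add: pixley_roy_basic_Int)
    show ?thesis
    proof (cases "F \<union> G \<subseteq> U \<inter> V")
      case True
      have "finite (F \<union> G) \<and> F \<union> G \<noteq> {} \<and> open (U \<inter> V) \<and> F \<union> G \<subseteq> U \<inter> V"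
        using F G True by (simp add: open_Int)
      then have "S \<inter> T \<in> pixley_roy_base"
        unfolding eq pixley_roy_base_def by blast
      then show ?thesis
        by (simp add: arbitrary_union_of_inc)
    next
      case False
      then have "S \<inter> T = {}"
        unfolding eq pixley_roy_basic_def by blast
      then show ?thesis
        by simp
    qed
  qed
  then have "istopology (arbitrary union_of (\<lambda>B. B \<in> pixley_roy_base))"
    by (simp add: istopology_base_eq)
  then show ?thesis
    by (simp add: base_in_def pixley_roy_def topology_inverse')
qed

lemma topspace_pixley_roy: "topspace pixley_roy = {F. finite F \<and> F \<noteq> {}}"
proof
  have sub: "B \<subseteq> {F. finite F \<and> F \<noteq> {}}" if "B \<in> pixley_roy_base" for B
    using that by (auto simp: pixley_roy_base_def pixley_roy_basic_def)
  have "(arbitrary union_of (\<lambda>B. B \<in> pixley_roy_base)) (topspace pixley_roy)"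
    using base_in_pixley_roy openin_topspace unfolding base_in_def by metis
  then show "topspace pixley_roy \<subseteq> {F. finite F \<and> F \<noteq> {}}"
    using sub unfolding union_of_def by fastforce
  have "F \<in> topspace pixley_roy" if "finite F" "F \<noteq> {}" for F
  proof -
    have "pixley_roy_basic F UNIV \<in> pixley_roy_base"
      using that unfolding pixley_roy_base_def by blast
    then have "openin pixley_roy (pixley_roy_basic F UNIV)"
      using base_in_pixley_roy unfolding base_in_def by (simp add: arbitrary_union_of_inc)
    moreover have "F \<in> pixley_roy_basic F UNIV"
      using that by (simp add: pixley_roy_basic_def)
    ultimately show ?thesis
      using openin_subset by blast
  qed
  then show "{F. finite F \<and> F \<noteq> {}} \<subseteq> topspace pixley_roy"
    by blast
qed


section \<open>Set-theoretic axioms\<close>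

text \<open>Cardinals below the continuum are expressed by \<open>\<prec>\<close> against \<open>UNIV :: nat set set\<close>, a set of
  cardinality $2^{\aleph_0}$.  Quantification over all sets is not available inside HOL, so
  \<open>martins_axiom\<close> and \<open>PMEA\<close> carry a type argument and range over the posets, respectively the
  index sets, carried by subsets of that type.\<close>

definition continuum_hypothesis :: bool where
  "continuum_hypothesis \<longleftrightarrow> (card_of (UNIV :: nat set set), cardSuc natLeq) \<in> ordIso"

text \<open>\<open>(p, q) \<in> r\<close> means that \<open>p\<close> is below, i.e. stronger than, \<open>q\<close>.\<close>

definition compatible_in :: "'p set \<Rightarrow> 'p rel \<Rightarrow> 'p \<Rightarrow> 'p \<Rightarrow> bool" where
  "compatible_in P r p q \<longleftrightarrow> (\<exists>s\<in>P. (s, p) \<in> r \<and> (s, q) \<in> r)"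

definition ccc_poset :: "'p set \<Rightarrow> 'p rel \<Rightarrow> bool" where
  "ccc_poset P r \<longleftrightarrow>
     partial_order_on P r \<and> P \<noteq> {} \<and>
     (\<forall>A\<subseteq>P. pairwise (\<lambda>p q. \<not> compatible_in P r p q) A \<longrightarrow> countable A)"

definition dense_in_poset :: "'p set \<Rightarrow> 'p rel \<Rightarrow> 'p set \<Rightarrow> bool" where
  "dense_in_poset P r D \<longleftrightarrow> D \<subseteq> P \<and> (\<forall>p\<in>P. \<exists>d\<in>D. (d, p) \<in> r)"

definition filter_in_poset :: "'p set \<Rightarrow> 'p rel \<Rightarrow> 'p set \<Rightarrow> bool" where
  "filter_in_poset P r G \<longleftrightarrow>
     G \<subseteq> P \<and> G \<noteq> {} \<and>
     (\<forall>p\<in>G. \<forall>q\<in>P. (p, q) \<in> r \<longrightarrow> q \<in> G) \<and>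
     (\<forall>p\<in>G. \<forall>q\<in>G. \<exists>s\<in>G. (s, p) \<in> r \<and> (s, q) \<in> r)"

definition martins_axiom :: "'p itself \<Rightarrow> bool" where
  "martins_axiom _ \<longleftrightarrow>
     (\<forall>(P :: 'p set) r \<D>.
        ccc_poset P r \<and> (\<forall>D\<in>\<D>. dense_in_poset P r D) \<and> \<D> \<prec> (UNIV :: nat set set)
        \<longrightarrow> (\<exists>G. filter_in_poset P r G \<and> (\<forall>D\<in>\<D>. G \<inter> D \<noteq> {})))"

text \<open>The sum over a possibly uncountable family in \<open>ennreal\<close> is the supremum of its finite subsums.\<close>

definition continuum_additive :: "'b measure \<Rightarrow> bool" where
  "continuum_additive \<nu> \<longleftrightarrow>
     (\<forall>\<A>. \<A> \<subseteq> sets \<nu> \<and> disjoint \<A> \<and> \<A> \<prec> (UNIV :: nat set set)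
        \<longrightarrow> \<Union>\<A> \<in> sets \<nu> \<and> emeasure \<nu> (\<Union>\<A>) = (\<Sum>\<^sub>\<infinity>A\<in>\<A>. emeasure \<nu> A))"

definition coin_product :: "'i set \<Rightarrow> ('i \<Rightarrow> bool) measure" where
  "coin_product K = PiM K (\<lambda>_. uniform_count_measure (UNIV :: bool set))"

definition PMEA :: "'i itself \<Rightarrow> bool" where
  "PMEA _ \<longleftrightarrow>
     (\<forall>K :: 'i set. \<exists>\<nu>.
        space \<nu> = space (coin_product K) \<and>
        sets \<nu> = Pow (space (coin_product K)) \<and>
        (\<forall>A\<in>sets (coin_product K). emeasure \<nu> A = emeasure (coin_product K) A) \<and>
        continuum_additive \<nu>)"

end

(* A Pixley-Roy space over a subset A of the reals has a \<sigma>-centred base, so a strongly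
   point-finite family of non-empty open sets is countable in it. Hence a \<sigma>-strongly point-finite
   almost subbase would be countable and the space second countable, which forces A to be countable.

   Under MA + not CH take A uncountable with card A < 2^aleph_0. Finite promises of neighbourhoods for
   the points of two disjoint closed sets, kept disjoint on opposite sides, form a \<sigma>-centred poset,
   and a filter meeting fewer than continuum many dense sets separates the two sets.

   Under PMEA, Nyikos' argument separates discrete families of closed sets in normal first countable
   spaces. The members of low rank in a uniform base form point-finite families; the points in exactly
   k of them split into countably many discrete closed families, whose separations make up a
   \<sigma>-disjoint base. Open sets are F_sigma, hence cozero-sets, so this base is an almost subbase. *)

theory Submission
  imports Defs "HOL-Probability.Probability"
begin

section \<open>Pixley--Roy spaces of subsets of the real line\<close>

text \<open>One family of spaces serves both negative results: the whole line gives (1). For (2) the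
  poset needs one dense set for each point of the two closed sets, and the points are finite subsets
  of \<open>A\<close>; over the whole line there could be continuum many of them, which MA does not
  handle. The countability of \<open>A\<close> in a second countable space comes from the singletons
  \<open>{x}\<close>, which form a discrete subspace.

  The obstacle in (2) is that uncountably many conditions must receive countably many codes. Real
  points are rounded to a grid, and closed thickenings leave a positive margin that survives the
  rounding.

  The obstacle in (3) is that discrete families need closed members, while the points in exactly k
  members form only an open set minus an open set; this is where open sets being F_sigma enters a
  first time, before it yields cozero-sets. Isolated points lie in only finitely many base members,
  so arguments with infinite local families do not reach them and they are treated apart.

  Each axiom is assumed at one type: conditions are therefore coded as sets of reals, and members of
  a discrete family by points of the space.\<close>

definition PR :: "real set \<Rightarrow> real set topology" where
  "PR A = subtopology pixley_roy (Pow A)"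

definition thicken :: "nat \<Rightarrow> real set \<Rightarrow> real set" where
  "thicken n F = (\<Union>x\<in>F. ball x (1 / Suc n))"

definition cell :: "real set \<Rightarrow> real set \<Rightarrow> nat \<Rightarrow> real set set" where
  "cell A F n = {G \<in> Fpow A - {{}}. F \<subseteq> G \<and> G \<subseteq> thicken n F}"

lemma PR_UNIV: "PR UNIV = pixley_roy"
  by (simp add: PR_def)

lemma topspace_PR: "topspace (PR A) = Fpow A - {{}}"
  by (auto simp: PR_def topspace_pixley_roy Fpow_def)

lemma open_thicken: "open (thicken n F)"
  by (auto simp: thicken_def)

lemma subset_thicken: "F \<subseteq> thicken n F"
  by (auto simp: thicken_def)

lemma thicken_antimono: "m \<le> n \<Longrightarrow> thicken n F \<subseteq> thicken m F"
  unfolding thicken_def by (intro UN_mono subset_ball) (auto simp: frac_le)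

text \<open>Finiteness of \<open>F\<close> lets one radius serve all its points. This makes the
  cells with a single integer parameter a neighbourhood base at \<open>F\<close>.\<close>

lemma thicken_subset_open:
  assumes "finite F" "open U" "F \<subseteq> U"
  shows "\<exists>n. thicken n F \<subseteq> U"
  using assms(1,3)
proof (induction F)
  case empty
  then show ?case by (simp add: thicken_def)
next
  case (insert x F)
  then obtain n where n: "thicken n F \<subseteq> U" by auto
  obtain e where e: "e > 0" "ball x e \<subseteq> U"
    using insert.prems \<open>open U\<close> open_contains_ball by blast
  obtain m where m: "1 / Suc m < e"
    using e(1) nat_approx_posE by blast
  have "ball x (1 / Suc (max m n)) \<subseteq> ball x e"
    using m by (intro subset_ball) (smt (verit) frac_le max.cobounded1 of_nat_0_less_iff of_nat_le_iff Suc_le_mono zero_less_Suc)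
  moreover have "thicken (max m n) F \<subseteq> thicken n F"
    by (simp add: thicken_antimono)
  ultimately have "thicken (max m n) (insert x F) \<subseteq> U"
    using e(2) n unfolding thicken_def by blast
  then show ?case ..
qed

lemma not_in_thicken:
  assumes "finite F" "x \<notin> F"
  shows "\<exists>n. x \<notin> thicken n F"
  using thicken_subset_open[of F "- {x}"] assms by blast

lemma cell_antimono: "m \<le> n \<Longrightarrow> cell A F n \<subseteq> cell A F m"
  using thicken_antimono unfolding cell_def by blast

lemma centre_in_cell: "F \<in> Fpow A - {{}} \<Longrightarrow> F \<in> cell A F n"
  by (simp add: cell_def subset_thicken)

text \<open>Either \<open>G\<close> misses a point of \<open>F\<close> and lies in no cell about
  \<open>F\<close>, or \<open>G\<close> has an extra point, which a small radius excludes.\<close>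

lemma not_in_cell:
  assumes "finite F" "G \<noteq> F"
  shows "\<exists>n. G \<notin> cell A F n"
proof (cases "F \<subseteq> G")
  case True
  then obtain x where "x \<in> G" "x \<notin> F" using assms by blast
  then show ?thesis using not_in_thicken[OF assms(1)] by (auto simp: cell_def)
qed (auto simp: cell_def)

lemma openin_PR_iff:
  "openin (PR A) W \<longleftrightarrow> W \<subseteq> Fpow A - {{}} \<and> (\<forall>F\<in>W. \<exists>n. cell A F n \<subseteq> W)"
proof
  assume W: "openin (PR A) W"
  then obtain W' where W': "openin pixley_roy W'" "W = W' \<inter> Pow A"
    by (auto simp: PR_def openin_subtopology)
  have "\<exists>n. cell A F n \<subseteq> W" if "F \<in> W" for F
  proof -
    obtain B where B: "B \<in> pixley_roy_base" "F \<in> B" "B \<subseteq> W'"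
      using W' \<open>F \<in> W\<close> base_in_pixley_roy by (auto simp: base_in_def arbitrary_union_of_alt)
    then obtain F0 U where FU: "B = pixley_roy_basic F0 U" "open U"
      by (auto simp: pixley_roy_base_def)
    then obtain n where "thicken n F \<subseteq> U"
      using B(2) thicken_subset_open[of F U] by (auto simp: pixley_roy_basic_def)
    then have "cell A F n \<subseteq> B"
      using FU B(2) by (auto simp: cell_def pixley_roy_basic_def Fpow_def)
    then have "cell A F n \<subseteq> W"
      using B(3) W'(2) by (auto simp: cell_def Fpow_def)
    then show ?thesis ..
  qed
  then show "W \<subseteq> Fpow A - {{}} \<and> (\<forall>F\<in>W. \<exists>n. cell A F n \<subseteq> W)"
    using W openin_subset topspace_PR by blast
next
  assume W: "W \<subseteq> Fpow A - {{}} \<and> (\<forall>F\<in>W. \<exists>n. cell A F n \<subseteq> W)"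
  then obtain n where n: "\<And>F. F \<in> W \<Longrightarrow> cell A F (n F) \<subseteq> W" by metis
  have open_basic: "openin pixley_roy (pixley_roy_basic F (thicken (n F) F))" if "F \<in> W" for F
  proof -
    have "pixley_roy_basic F (thicken (n F) F) \<in> pixley_roy_base"
      using W that open_thicken subset_thicken unfolding pixley_roy_base_def Fpow_def by blast
    then show ?thesis
      using base_in_pixley_roy by (simp add: base_in_def arbitrary_union_of_inc)
  qed
  have eq: "pixley_roy_basic F (thicken m F) \<inter> Pow A = cell A F m" for F m
    by (auto simp: pixley_roy_basic_def cell_def Fpow_def)
  have "W = (\<Union>F\<in>W. cell A F (n F))"
    using n W centre_in_cell by blast
  also have "\<dots> = (\<Union>F\<in>W. pixley_roy_basic F (thicken (n F) F)) \<inter> Pow A"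
    by (simp flip: eq)
  finally have "W = (\<Union>F\<in>W. pixley_roy_basic F (thicken (n F) F)) \<inter> Pow A" .
  moreover have "openin pixley_roy (\<Union>F\<in>W. pixley_roy_basic F (thicken (n F) F))"
    using open_basic by blast
  ultimately show "openin (PR A) W"
    unfolding PR_def openin_subtopology by blast
qed

lemma openin_cell: "openin (PR A) (cell A F n)"
  unfolding openin_PR_iff
proof (intro conjI ballI)
  fix G assume G: "G \<in> cell A F n"
  then obtain m where m: "thicken m G \<subseteq> thicken n F"
    using thicken_subset_open[of G "thicken n F"] open_thicken by (auto simp: cell_def Fpow_def)
  then have "cell A G m \<subseteq> cell A F n"
    using G by (auto simp: cell_def)
  then show "\<exists>m. cell A G m \<subseteq> cell A F n" ..
qed (auto simp: cell_def)

text \<open>There are two ways to lie outside a cell. A point of \<open>G\<close> outside the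
  thickening stays in every superset of \<open>G\<close>, so any radius works; a point of
  \<open>F\<close> missing from \<open>G\<close> is kept out by a small radius about
  \<open>G\<close>.\<close>

lemma closedin_cell: "closedin (PR A) (cell A F n)"
  unfolding closedin_def openin_PR_iff topspace_PR
proof (intro conjI ballI)
  fix G assume G: "G \<in> Fpow A - {{}} - cell A F n"
  show "\<exists>m. cell A G m \<subseteq> Fpow A - {{}} - cell A F n"
  proof (cases "F \<subseteq> G")
    case True
    then have "\<not> G \<subseteq> thicken n F" using G by (auto simp: cell_def)
    then have "cell A G 0 \<subseteq> Fpow A - {{}} - cell A F n" by (auto simp: cell_def)
    then show ?thesis ..
  next
    case False
    then obtain x where x: "x \<in> F" "x \<notin> G" by blast
    then obtain m where "x \<notin> thicken m G"
      using not_in_thicken[of G x] G unfolding Fpow_def by blast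
    then have "cell A G m \<subseteq> Fpow A - {{}} - cell A F n" using x by (auto simp: cell_def)
    then show ?thesis ..
  qed
qed (auto simp: cell_def)

text \<open>Cells are clopen, so two-valued functions separate points from closed sets.\<close>

lemma Tychonoff_PR: "Tychonoff_space (PR A)"
  unfolding Tychonoff_space_def
proof
  show "completely_regular_space (PR A)"
    unfolding completely_regular_space_def
  proof (intro allI impI)
    fix S x assume Sx: "closedin (PR A) S \<and> x \<in> topspace (PR A) - S"
    then obtain n where n: "cell A x n \<subseteq> topspace (PR A) - S"
      by (meson closedin_def openin_PR_iff)
    define f where "f = (\<lambda>G. if G \<in> cell A x n then 0 else (1::real))"
    have sub: "cell A x n \<subseteq> topspace (PR A)"
      by (simp add: openin_cell openin_subset)
    have "openin (PR A) {G \<in> topspace (PR A). f G \<in> T}" for T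
    proof -
      have "openin (PR A) (topspace (PR A) - cell A x n)"
        using closedin_cell by blast
      moreover have "{G \<in> topspace (PR A). f G \<in> T} =
          (if 0 \<in> T then cell A x n else {}) \<union> (if 1 \<in> T then topspace (PR A) - cell A x n else {})"
        using sub by (auto simp: f_def)
      ultimately show ?thesis
        using openin_cell by auto
    qed
    then have "continuous_map (PR A) (top_of_set {0..1}) f"
      by (auto simp: continuous_map_def f_def)
    moreover have "f x = 0"
      using Sx by (simp add: f_def centre_in_cell topspace_PR)
    moreover have "f ` S \<subseteq> {1}"
      using n by (auto simp: f_def)
    ultimately show "\<exists>f. continuous_map (PR A) (top_of_set {0..1::real}) f \<and> f x = 0 \<and> f ` S \<subseteq> {1}"
      by blast
  qed
  show "t1_space (PR A)"
    unfolding t1_space_def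
  proof (intro ballI impI)
    fix F G assume "F \<in> topspace (PR A)" "G \<in> topspace (PR A)" "F \<noteq> G"
    then obtain n where "G \<notin> cell A F n"
      using not_in_cell unfolding topspace_PR Fpow_def by blast
    then show "\<exists>U. openin (PR A) U \<and> F \<in> U \<and> G \<notin> U"
      using \<open>F \<in> topspace (PR A)\<close> centre_in_cell openin_cell topspace_PR by metis
  qed
qed

text \<open>A cell containing \<open>G\<close> is centred at a subset of \<open>G\<close>, which
  leaves finitely many centres, and a centre other than \<open>G\<close> admits finitely many radii.
  So an infinite family of cells containing \<open>G\<close> includes arbitrarily small ones centred
  at \<open>G\<close>.\<close>

lemma has_uniform_base_PR: "has_uniform_base (PR A)"
proof -
  define \<B> where "\<B> = {cell A F n |F n. F \<in> Fpow A - {{}}}"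
  have "openin (PR A) W \<longleftrightarrow> (arbitrary union_of (\<lambda>B. B \<in> \<B>)) W" for W
  proof
    assume W: "openin (PR A) W"
    show "(arbitrary union_of (\<lambda>B. B \<in> \<B>)) W"
      unfolding arbitrary_union_of_alt
    proof
      fix F assume "F \<in> W"
      then show "\<exists>B. B \<in> \<B> \<and> F \<in> B \<and> B \<subseteq> W"
        using W centre_in_cell unfolding openin_PR_iff \<B>_def by blast
    qed
  next
    assume "(arbitrary union_of (\<lambda>B. B \<in> \<B>)) W"
    then show "openin (PR A) W"
      unfolding union_of_def \<B>_def using openin_cell by blast
  qed
  then have base: "base_in (PR A) \<B>"
    by (auto simp: base_in_def)
  have "base_at (PR A) G \<C>"
    if G: "G \<in> topspace (PR A)" and \<C>: "\<C> \<subseteq> \<B>" "infinite \<C>" "\<forall>C\<in>\<C>. G \<in> C" for G \<C>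
    unfolding base_at_def
  proof (intro conjI ballI allI impI)
    fix C assume "C \<in> \<C>"
    then show "openin (PR A) C" "G \<in> C"
      using \<C> openin_cell by (auto simp: \<B>_def)
  next
    fix W assume W: "openin (PR A) W \<and> G \<in> W"
    then obtain k where k: "cell A G k \<subseteq> W"
      by (auto simp: openin_PR_iff)
    have finG: "finite G" using G by (auto simp: topspace_PR Fpow_def)
    have "\<exists>N. \<forall>n. G \<in> cell A F n \<longrightarrow> F = G \<or> n < N" if "finite F" for F
      using not_in_cell[OF that, of G A] cell_antimono by (metis in_mono not_le)
    then obtain N where N: "\<And>F n. finite F \<Longrightarrow> G \<in> cell A F n \<Longrightarrow> F = G \<or> n < N F"
      by metis
    \<comment> \<open>The union is finite. A cell outside it that contains \<open>G\<close> has
      index at least \<open>N F\<close>, which forces the centre to be \<open>G\<close>, and at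
      least \<open>k\<close>, which puts it inside \<open>W\<close>.\<close>
    have "\<not> \<C> \<subseteq> (\<Union>F\<in>Pow G. cell A F ` {..<N F + k})"
      using \<C>(2) finG by (meson finite_Pow_iff finite_UN finite_imageI finite_lessThan finite_subset)
    then obtain C where C: "C \<in> \<C>" "C \<notin> (\<Union>F\<in>Pow G. cell A F ` {..<N F + k})"
      by blast
    then obtain F n where Fn: "C = cell A F n" "F \<in> Fpow A - {{}}"
      using \<C>(1) unfolding \<B>_def by blast
    have GC: "G \<in> cell A F n" using C(1) Fn \<C>(3) by blast
    then have "F \<in> Pow G" by (auto simp: cell_def)
    then have "\<not> n < N F + k" using C(2) Fn by blast
    moreover have "F = G \<or> n < N F" using N GC Fn by (auto simp: Fpow_def)
    ultimately have "F = G" "k \<le> n" by auto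
    then have "C \<subseteq> W" using k Fn cell_antimono by blast
    then show "\<exists>C\<in>\<C>. C \<subseteq> W" using C(1) by blast
  qed
  then have "uniform_base_in (PR A) \<B>"
    using base by (simp add: uniform_base_in_def)
  then show ?thesis
    unfolding has_uniform_base_def ..
qed

section \<open>Countability of strongly point-finite open families and failure of the
  E-property\<close>

text \<open>Finite unions of members of a countable base of the line suffice.\<close>

lemma countable_interpolating_sets:
  obtains \<R> :: "real set set"
  where "countable \<R>" "\<And>F U. finite F \<Longrightarrow> open U \<Longrightarrow> F \<subseteq> U \<Longrightarrow> \<exists>R\<in>\<R>. F \<subseteq> R \<and> R \<subseteq> U"
proof -
  obtain B :: "real set set" where B: "countable B" "topological_basis B"
    using ex_countable_basis by blast
  have "\<exists>R\<in>Union ` Fpow B. F \<subseteq> R \<and> R \<subseteq> U" if F: "finite F" "open U" "F \<subseteq> U" for F U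
  proof -
    have "\<forall>x\<in>F. \<exists>b\<in>B. x \<in> b \<and> b \<subseteq> U"
      using topological_basisE[OF B(2)] F by (metis in_mono)
    then obtain b where "\<And>x. x \<in> F \<Longrightarrow> b x \<in> B \<and> x \<in> b x \<and> b x \<subseteq> U" by metis
    then have "b ` F \<in> Fpow B" "F \<subseteq> \<Union>(b ` F)" "\<Union>(b ` F) \<subseteq> U"
      using F by (auto simp: Fpow_def)
    then show ?thesis by blast
  qed
  then show thesis
    using that[of "Union ` Fpow B"] B(1) by (simp add: countable_Fpow)
qed

text \<open>The basic sets \<open>[F, U]\<close> with \<open>F \<subseteq> R \<subseteq> U\<close> are centred for each fixed \<open>R\<close>, and countably many \<open>R\<close>
  suffice; hence only finitely many members of a strongly point-finite family share the same \<open>R\<close>.\<close>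

lemma countable_strongly_point_finite_PR:
  assumes spf: "strongly_point_finite \<V>" and op: "\<And>V. V \<in> \<V> \<Longrightarrow> openin (PR A) V"
  shows "countable \<V>"
proof -
  obtain \<R> :: "real set set" where \<R>: "countable \<R>"
    and interp: "\<And>F U. finite F \<Longrightarrow> open U \<Longrightarrow> F \<subseteq> U \<Longrightarrow> \<exists>R\<in>\<R>. F \<subseteq> R \<and> R \<subseteq> U"
    using countable_interpolating_sets by blast
  have "\<exists>F R. F \<in> V \<and> R \<in> \<R> \<and> F \<subseteq> R \<and> (\<forall>G\<in>Fpow A. F \<subseteq> G \<and> G \<subseteq> R \<longrightarrow> G \<in> V)"
    if V: "V \<in> \<V> - {{}}" for V
  proof -
    obtain F where F: "F \<in> V" using V by blast
    obtain n where n: "cell A F n \<subseteq> V" and "F \<in> Fpow A - {{}}"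
      using op[of V] V F unfolding openin_PR_iff by blast
    then obtain R where R: "R \<in> \<R>" "F \<subseteq> R" "R \<subseteq> thicken n F"
      using interp[of F "thicken n F"] open_thicken subset_thicken by (auto simp: Fpow_def)
    have "G \<in> V" if "G \<in> Fpow A" "F \<subseteq> G" "G \<subseteq> R" for G
      using n that R \<open>F \<in> Fpow A - {{}}\<close> unfolding cell_def by blast
    then show ?thesis using F R by blast
  qed
  then obtain F R where FR: "\<And>V. V \<in> \<V> - {{}} \<Longrightarrow> F V \<in> V \<and> R V \<in> \<R> \<and> F V \<subseteq> R V"
    and cen: "\<And>V G. V \<in> \<V> - {{}} \<Longrightarrow> G \<in> Fpow A \<Longrightarrow> F V \<subseteq> G \<Longrightarrow> G \<subseteq> R V \<Longrightarrow> G \<in> V"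
    by metis
  have "finite {V \<in> \<V> - {{}}. R V = Q}" for Q
  proof (rule ccontr)
    assume "infinite {V \<in> \<V> - {{}}. R V = Q}"
    then obtain \<beta> where \<beta>: "\<beta> \<subseteq> {V \<in> \<V> - {{}}. R V = Q}" "countable \<beta>" "infinite \<beta>"
      using infinite_countable_subset' by blast
    then have "\<beta> \<subseteq> \<V>" by blast
    then obtain \<gamma> where \<gamma>: "\<gamma> \<subseteq> \<beta>" "finite \<gamma>" "\<gamma> \<noteq> {}" "\<Inter>\<gamma> = {}"
      using spf \<beta> unfolding strongly_point_finite_def by meson
    have "F V \<in> Fpow A" if "V \<in> \<gamma>" for V
    proof -
      have "V \<in> \<V> - {{}}" using that \<beta>(1) \<gamma>(1) by blast
      then show ?thesis using FR[of V] op[of V] by (auto simp: openin_PR_iff)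
    qed
    \<comment> \<open>The union of the chosen centres is a point common to all of \<gamma>: each
      centre lies below its own \<open>R V\<close>, and all these sets are the same
      \<open>Q\<close>.\<close>
    then have "(\<Union>V\<in>\<gamma>. F V) \<in> Fpow A"
      using \<gamma>(2) by (auto simp: Fpow_def)
    moreover have "(\<Union>V\<in>\<gamma>. F V) \<subseteq> R V" if "V \<in> \<gamma>" for V
      using FR that \<beta>(1) \<gamma>(1) by blast
    ultimately have "(\<Union>V\<in>\<gamma>. F V) \<in> V" if "V \<in> \<gamma>" for V
      using cen[of V "\<Union>V\<in>\<gamma>. F V"] that \<beta>(1) \<gamma>(1) by blast
    then show False using \<gamma> by blast
  qed
  then have "countable (\<Union>Q\<in>\<R>. {V \<in> \<V> - {{}}. R V = Q})"
    using \<R> by (simp add: countable_finite)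
  \<comment> \<open>The empty set offers no centre to choose, so it is added back by hand.\<close>
  moreover have "\<V> \<subseteq> insert {} (\<Union>Q\<in>\<R>. {V \<in> \<V> - {{}}. R V = Q})"
    using FR by blast
  ultimately show ?thesis
    by (meson countable_insert countable_subset)
qed

lemma not_E_space_PR:
  assumes A: "uncountable A"
  shows "\<not> E_space (PR A)"
proof
  assume "E_space (PR A)"
  then obtain \<alpha> where as: "almost_subbase_in (PR A) \<alpha>" and \<sigma>: "sigma_strongly_point_finite \<alpha>"
    by (auto simp: E_space_def)
  obtain U where "subbase_in (PR A) (\<alpha> \<union> {topspace (PR A) - U V (2 * k - 1 :: nat) |V k. V \<in> \<alpha> \<and> k \<ge> 1})"
    using as unfolding almost_subbase_in_def by blast
  then obtain S where S: "S = \<alpha> \<union> {topspace (PR A) - U V (2 * k - 1) |V k. V \<in> \<alpha> \<and> k \<ge> 1}"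
    and sub: "S \<subseteq> Pow (topspace (PR A))"
    and op: "openin (PR A) = arbitrary union_of (finite intersection_of (\<lambda>V. V \<in> S) relative_to topspace (PR A))"
    unfolding subbase_in_def by blast
  have "openin (PR A) V" if "V \<in> S" for V
  proof -
    have "(finite intersection_of (\<lambda>V. V \<in> S) relative_to topspace (PR A)) (topspace (PR A) \<inter> V)"
      by (simp add: finite_intersection_of_inc relative_to_inc that)
    then have "openin (PR A) (topspace (PR A) \<inter> V)"
      unfolding op by (rule arbitrary_union_of_inc)
    moreover have "topspace (PR A) \<inter> V = V" using sub that by blast
    ultimately show ?thesis by simp
  qed
  note op_S = this
  obtain N where N: "\<alpha> = (\<Union>n::nat. N n)" "\<And>n. strongly_point_finite (N n)"
    using \<sigma> unfolding sigma_strongly_point_finite_def by blast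
  have "countable (N n)" for n
    using countable_strongly_point_finite_PR[OF N(2)] op_S by (auto simp: S N(1))
  then have "countable \<alpha>"
    by (simp add: N(1))
  moreover have "{topspace (PR A) - U V (2 * k - 1) |V k. V \<in> \<alpha> \<and> k \<ge> 1}
      \<subseteq> (\<lambda>(V,k). topspace (PR A) - U V (2 * k - 1)) ` (\<alpha> \<times> UNIV)"
    by auto
  ultimately have "countable S"
    unfolding S by (meson countableI_type countable_SIGMA countable_Un countable_image countable_subset)
  then have ctb: "countable (Fpow S)" by (rule countable_Fpow)
  have "\<exists>\<T>\<in>Fpow S. {x} \<in> \<Inter>\<T> \<and> topspace (PR A) \<inter> \<Inter>\<T> \<subseteq> cell A {x} 0" if "x \<in> A" for x
  proof -
    have x: "{x} \<in> Fpow A - {{}}" using that by (auto simp: Fpow_def)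
    have "openin (PR A) (cell A {x} 0)" by (rule openin_cell)
    then obtain W where W: "(finite intersection_of (\<lambda>V. V \<in> S) relative_to topspace (PR A)) W"
      "{x} \<in> W" "W \<subseteq> cell A {x} 0"
      unfolding op arbitrary_union_of_alt using centre_in_cell[OF x] by meson
    then obtain \<T> where "\<T> \<subseteq> S" "finite \<T>" "W = topspace (PR A) \<inter> \<Inter>\<T>"
      by (auto simp: relative_to_def intersection_of_def)
    then show ?thesis using W by (auto simp: Fpow_def intro!: bexI[of _ \<T>])
  qed
  then obtain \<T> where \<T>: "\<And>x. x \<in> A \<Longrightarrow> \<T> x \<in> Fpow S \<and> {x} \<in> \<Inter>(\<T> x) \<and> topspace (PR A) \<inter> \<Inter>(\<T> x) \<subseteq> cell A {x} 0"
    by metis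
  \<comment> \<open>The finite subfamily \<open>\<T> x\<close> determines \<open>x\<close>, since
    the only singleton in the cell about \<open>{x}\<close> is \<open>{x}\<close> itself.\<close>
  have "inj_on \<T> A"
  proof (rule inj_onI)
    fix x y assume xy: "x \<in> A" "y \<in> A" "\<T> x = \<T> y"
    have "{y} \<in> topspace (PR A)" using xy by (auto simp: topspace_PR Fpow_def)
    then have "{y} \<in> cell A {x} 0" using \<T>[OF xy(1)] \<T>[OF xy(2)] xy(3) by auto
    then show "x = y" by (auto simp: cell_def)
  qed
  moreover have "countable (\<T> ` A)"
    using ctb \<T> by (meson countable_subset image_subsetI)
  ultimately show False using A countable_image_inj_on by blast
qed

section \<open>Cardinalities\<close>

lemma Times_lepoll_infinite:
  assumes "infinite C" "A \<lesssim> C" "B \<lesssim> C"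
  shows "A \<times> B \<lesssim> C"
proof -
  have "C \<times> C \<approx> C"
    using card_of_Times_same_infinite[OF assms(1)] by (simp add: eqpoll_iff_card_of_ordIso)
  moreover have "A \<times> B \<lesssim> C \<times> C"
    using assms by (simp add: times_lepoll_mono)
  ultimately show ?thesis
    by (rule lepoll_trans2[rotated])
qed

lemma lepoll_iff_ordLeq: "A \<lesssim> B \<longleftrightarrow> (card_of A, card_of B) \<in> ordLeq"
  by (simp add: lepoll_def card_of_ordLeq)

lemma lesspoll_iff_ordLess: "A \<prec> B \<longleftrightarrow> (card_of A, card_of B) \<in> ordLess"
proof -
  have "A \<prec> B \<longleftrightarrow> \<not> B \<lesssim> A"
    using lepoll_iff_ordLeq card_of_ordLess[of B A] lepoll_antisym ordLess_imp_ordLeq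
    by (metis (no_types, lifting) card_of_ordLeq lepoll_def lesspoll_def eqpoll_imp_lepoll eqpoll_sym)
  then show ?thesis
    using card_of_ordLess[of B A] by (simp add: lepoll_def)
qed

lemma Fpow_lepoll_infinite:
  assumes "infinite A"
  shows "Fpow A \<lesssim> A"
proof -
  have card_n: "{F \<in> Fpow A. card F = n} \<lesssim> A" for n
  proof (induction n)
    case 0
    have "{F \<in> Fpow A. card F = 0} = {{}}"
      by (auto simp: Fpow_def)
    then show ?case
      using assms by (simp add: finite_lepoll_infinite)
  next
    case (Suc n)
    have "{F \<in> Fpow A. card F = Suc n} \<subseteq> (\<lambda>(x, F). insert x F) ` (A \<times> {F \<in> Fpow A. card F = n})"
    proof
      fix F assume "F \<in> {F \<in> Fpow A. card F = Suc n}"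
      then obtain x F' where "F = insert x F'" "card F' = n" "finite F'" "F \<subseteq> A"
        by (auto simp: card_Suc_eq Fpow_def)
      then show "F \<in> (\<lambda>(x, F). insert x F) ` (A \<times> {F \<in> Fpow A. card F = n})"
        by (force simp: Fpow_def)
    qed
    then have "{F \<in> Fpow A. card F = Suc n} \<lesssim> A \<times> {F \<in> Fpow A. card F = n}"
      by (rule subset_image_lepoll)
    also have "\<dots> \<lesssim> A"
      using assms Suc by (simp add: Times_lepoll_infinite)
    finally show ?case .
  qed
  have "Fpow A = (\<Union>n. {F \<in> Fpow A. card F = n})"
    by auto
  moreover have "(\<Union>n::nat. {F \<in> Fpow A. card F = n}) \<lesssim> A"
    using card_of_UNION_ordLeq_infinite[OF assms, of "UNIV :: nat set" "\<lambda>n. {F \<in> Fpow A. card F = n}"]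
      card_n infinite_le_lepoll assms by (auto simp: lepoll_iff_ordLeq)
  ultimately show ?thesis by simp
qed

text \<open>The successor of aleph_0 is at most the continuum by Cantor's theorem and differs from
  it when CH fails. Its field is thus an uncountable set of the right size, which is then embedded
  in the reals.\<close>

lemma not_CH_uncountable_subset:
  assumes "\<not> continuum_hypothesis"
  obtains A :: "real set" where "uncountable A" "A \<prec> (UNIV :: nat set set)"
proof -
  define B where "B = Field (cardSuc natLeq)"
  have cS: "Card_order (cardSuc natLeq)"
    by (simp add: cardSuc_Card_order natLeq_Card_order)
  have iso: "(card_of B, cardSuc natLeq) \<in> ordIso"
    unfolding B_def using cS by (rule card_of_Field_ordIso)
  have "(natLeq, card_of (UNIV :: nat set set)) \<in> ordLess"
    using ordIso_ordLess_trans[OF ordIso_symmetric[OF card_of_nat]] lesspoll_Pow_self[of "UNIV :: nat set"]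
    by (simp add: lesspoll_iff_ordLess)
  then have "(cardSuc natLeq, card_of (UNIV :: nat set set)) \<in> ordLeq"
    by (rule cardSuc_least[OF natLeq_Card_order card_of_Card_order])
  moreover have "(cardSuc natLeq, card_of (UNIV :: nat set set)) \<notin> ordIso"
    using assms ordIso_symmetric unfolding continuum_hypothesis_def by blast
  ultimately have "(cardSuc natLeq, card_of (UNIV :: nat set set)) \<in> ordLess"
    by (simp add: ordLeq_iff_ordLess_or_ordIso)
  then have less: "B \<prec> (UNIV :: nat set set)"
    using iso ordIso_ordLess_trans lesspoll_iff_ordLess by blast
  have "(natLeq, card_of B) \<in> ordLess"
    using cardSuc_greater[OF natLeq_Card_order] iso ordIso_symmetric ordLess_ordIso_trans by blast
  then have "(card_of (UNIV :: nat set), card_of B) \<in> ordLess"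
    using card_of_nat ordIso_ordLess_trans by blast
  then have unc: "\<not> countable B"
    by (metis card_of_ordLess countable_def inj_on_def lesspoll_iff_ordLess subset_UNIV)
  obtain h :: "nat set \<Rightarrow> real" where "inj h"
    using nat_sets_eqpoll_reals by (auto simp: eqpoll_def bij_betw_def)
  then have "inj_on h B" by (meson inj_on_subset subset_UNIV)
  then have "uncountable (h ` B)" "h ` B \<prec> (UNIV :: nat set set)"
    using unc less countable_image_inj_on by (auto dest: countable_image_inj_on)
  then show thesis using that by blast
qed

section \<open>Martin's axiom and normality\<close>

text \<open>The axiom speaks of posets carried by one type only; an injection carries a poset over
  to that type and the generic filter back.\<close>

lemma martins_axiom_transfer:
  fixes P :: "'q set" and f :: "'q \<Rightarrow> 'p"
  assumes MA: "martins_axiom TYPE('p)" and ccc: "ccc_poset P r" and f: "inj_on f P"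
    and dense: "\<And>D. D \<in> \<D> \<Longrightarrow> dense_in_poset P r D" and small: "\<D> \<prec> (UNIV :: nat set set)"
  obtains G where "filter_in_poset P r G" "\<And>D. D \<in> \<D> \<Longrightarrow> G \<inter> D \<noteq> {}"
proof -
  define r' where "r' = map_prod f f ` r"
  have rP: "r \<subseteq> P \<times> P" and po: "partial_order_on P r"
    using ccc by (auto simp: ccc_poset_def partial_order_on_def preorder_on_def refl_on_def)
  have r': "(f p, f q) \<in> r' \<longleftrightarrow> (p, q) \<in> r" if "p \<in> P" "q \<in> P" for p q
  proof
    assume "(f p, f q) \<in> r'"
    then obtain p' q' where "(p', q') \<in> r" "f p = f p'" "f q = f q'" by (auto simp: r'_def)
    then show "(p, q) \<in> r" using rP f that by (metis SigmaD1 SigmaD2 inj_onD subsetD)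
  qed (force simp: r'_def)
  have compat: "compatible_in (f ` P) r' (f p) (f q) \<longleftrightarrow> compatible_in P r p q" if "p \<in> P" "q \<in> P" for p q
    using that r' by (auto simp: compatible_in_def)
  have "partial_order_on (f ` P) r'"
    unfolding partial_order_on_def preorder_on_def
  proof (intro conjI)
    show "r' \<subseteq> f ` P \<times> f ` P" using rP by (auto simp: r'_def)
    show "refl_on (f ` P) r'"
      using po r' unfolding partial_order_on_def preorder_on_def refl_on_def by auto
    have r'E: "\<exists>p q. x = f p \<and> y = f q \<and> p \<in> P \<and> q \<in> P \<and> (p, q) \<in> r" if "(x, y) \<in> r'" for x y
      using that rP unfolding r'_def by auto
    have "trans r" "antisym r"
      using po by (auto simp: partial_order_on_def preorder_on_def)
    show "trans r'"
    proof (rule transI)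
      fix x y z assume "(x, y) \<in> r'" "(y, z) \<in> r'"
      then obtain p q z' where "x = f p" "y = f q" "z = f z'" "p \<in> P" "q \<in> P" "z' \<in> P" "(p, q) \<in> r"
        "(f q, f z') \<in> r'"
        using r'E by metis
      then show "(x, z) \<in> r'"
        using r' \<open>trans r\<close> by (metis transD)
    qed
    show "antisym r'"
    proof (rule antisymI)
      fix x y assume "(x, y) \<in> r'" "(y, x) \<in> r'"
      then obtain p q where "x = f p" "y = f q" "p \<in> P" "q \<in> P" "(p, q) \<in> r" "(f q, f p) \<in> r'"
        using r'E by metis
      then show "x = y"
        using r' \<open>antisym r\<close> by (metis antisymD)
    qed
  qed
  moreover have "countable A'" if A': "A' \<subseteq> f ` P" "pairwise (\<lambda>p q. \<not> compatible_in (f ` P) r' p q) A'" for A'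
  proof -
    obtain A where A: "A \<subseteq> P" "A' = f ` A"
      using A'(1) by (auto simp: subset_image_iff)
    have "pairwise (\<lambda>p q. \<not> compatible_in P r p q) A"
      using A'(2) A f compat unfolding pairwise_def inj_on_def by (metis image_eqI subsetD)
    then show ?thesis
      using ccc A by (simp add: ccc_poset_def)
  qed
  ultimately have "ccc_poset (f ` P) r'"
    using ccc by (simp add: ccc_poset_def)
  moreover have "dense_in_poset (f ` P) r' D'" if "D' \<in> image f ` \<D>" for D'
    using that dense r' unfolding dense_in_poset_def by (fastforce simp: subset_iff)
  moreover have "image f ` \<D> \<prec> (UNIV :: nat set set)"
    using small image_lepoll lesspoll_trans1 by blast
  ultimately obtain G' where G': "filter_in_poset (f ` P) r' G'" "\<And>D. D \<in> \<D> \<Longrightarrow> G' \<inter> f ` D \<noteq> {}"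
    using MA unfolding martins_axiom_def by (metis (no_types, lifting) imageI)
  define G where "G = {p \<in> P. f p \<in> G'}"
  have G'_eq: "G' = f ` G"
    using G'(1) by (auto simp: G_def filter_in_poset_def)
  have GP: "G \<subseteq> P" by (auto simp: G_def)
  have "filter_in_poset P r G"
    unfolding filter_in_poset_def
  proof (intro conjI ballI impI)
    show "G \<noteq> {}" using G'(1) G'_eq by (auto simp: filter_in_poset_def)
    show "q \<in> G" if "p \<in> G" "q \<in> P" "(p, q) \<in> r" for p q
      using G'(1) that r' GP unfolding filter_in_poset_def by (auto simp: G_def)
    show "\<exists>s\<in>G. (s, p) \<in> r \<and> (s, q) \<in> r" if "p \<in> G" "q \<in> G" for p q
    proof -
      have "\<exists>s\<in>G'. (s, f p) \<in> r' \<and> (s, f q) \<in> r'"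
        using G'(1) that unfolding filter_in_poset_def G_def by blast
      then show ?thesis using r' GP that unfolding G'_eq by blast
    qed
  qed (rule GP)
  moreover have "G \<inter> D \<noteq> {}" if "D \<in> \<D>" for D
  proof -
    obtain d where "d \<in> D" "f d \<in> G'" using G'(2)[OF \<open>D \<in> \<D>\<close>] by blast
    moreover have "d \<in> P" using dense[OF \<open>D \<in> \<D>\<close>] \<open>d \<in> D\<close> by (auto simp: dense_in_poset_def)
    ultimately show ?thesis by (auto simp: G_def)
  qed
  ultimately show thesis using that by blast
qed

section \<open>Metric separation of cells and its countable coding\<close>

definition cthicken :: "nat \<Rightarrow> real set \<Rightarrow> real set" where
  "cthicken n F = (\<Union>x\<in>F. cball x (1 / Suc n))"

text \<open>Closed thickenings make \<open>apart\<close> an open condition on the points of both sets; \<open>robustly_apart\<close>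
  makes this quantitative.\<close>

definition apart :: "real set \<times> nat \<Rightarrow> real set \<times> nat \<Rightarrow> bool" where
  "apart s t \<longleftrightarrow> \<not> (fst s \<subseteq> cthicken (snd t) (fst t) \<and> fst t \<subseteq> cthicken (snd s) (fst s))"

definition robustly_apart :: "nat \<Rightarrow> real set \<times> nat \<Rightarrow> real set \<times> nat \<Rightarrow> bool" where
  "robustly_apart m s t \<longleftrightarrow>
     (\<exists>x\<in>fst s. \<forall>y\<in>fst t. 1 / Suc (snd t) + 1 / Suc m \<le> dist x y) \<or>
     (\<exists>y\<in>fst t. \<forall>x\<in>fst s. 1 / Suc (snd s) + 1 / Suc m \<le> dist x y)"

text \<open>Rounding to multiples of 1/(m+1). Sets with equal codes are within that distance of each
  other in the Hausdorff sense, and finite sets have only countably many codes.\<close>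

definition grid :: "nat \<Rightarrow> real set \<Rightarrow> int set" where
  "grid m F = (\<lambda>x. \<lfloor>Suc m * x\<rfloor>) ` F"

lemma in_cthicken_iff: "x \<in> cthicken n F \<longleftrightarrow> (\<exists>y\<in>F. dist y x \<le> 1 / Suc n)"
  by (auto simp: cthicken_def)

lemma thicken_subset_cthicken: "thicken n F \<subseteq> cthicken n F"
  by (auto simp: thicken_def cthicken_def less_imp_le)

lemma cthicken_subset_thicken: "m < n \<Longrightarrow> cthicken n F \<subseteq> thicken m F"
proof -
  assume "m < n"
  then have "1 / real (Suc n) < 1 / real (Suc m)"
    by (simp add: frac_less2)
  then show ?thesis
    unfolding thicken_def cthicken_def by force
qed

lemma cthicken_antimono: "m \<le> n \<Longrightarrow> cthicken n F \<subseteq> cthicken m F"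
  unfolding cthicken_def by (intro UN_mono subset_cball) (auto simp: frac_le)

lemma apart_sym: "apart s t \<longleftrightarrow> apart t s"
  by (auto simp: apart_def)

lemma apart_mono: "apart (F, n) t \<Longrightarrow> n \<le> n' \<Longrightarrow> apart (F, n') t"
  using cthicken_antimono by (fastforce simp: apart_def)

text \<open>A common element would contain both centres and lie in both thickenings, so each centre
  would lie in the thickening of the other.\<close>

lemma disjnt_cells_if_apart: "apart (F, n) (G, k) \<Longrightarrow> disjnt (cell A F n) (cell A G k)"
  using thicken_subset_cthicken unfolding apart_def disjnt_def cell_def by fastforce

lemma ex_uniform_gap:
  assumes "finite G" "\<And>y. y \<in> G \<Longrightarrow> c < dist (x :: real) y"
  shows "\<exists>m. \<forall>y\<in>G. c + 1 / Suc m \<le> dist x y"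
  using assms
proof (induction G)
  case (insert y G)
  then obtain m where m: "\<forall>y\<in>G. c + 1 / Suc m \<le> dist x y" by auto
  obtain l where l: "1 / Suc l < dist x y - c"
    using insert.prems nat_approx_posE by (metis diff_gt_0_iff_gt insertI1)
  have "1 / Suc (max l m) \<le> 1 / Suc l" "1 / Suc (max l m) \<le> 1 / Suc m"
    by (auto simp: frac_le)
  then show ?case
    using l m by (intro exI[of _ "max l m"]) force
qed auto

lemma robustly_apart_if_apart:
  assumes "apart s t" "finite (fst s)" "finite (fst t)"
  shows "\<exists>m. robustly_apart m s t"
proof -
  consider x where "x \<in> fst s" "x \<notin> cthicken (snd t) (fst t)"
    | y where "y \<in> fst t" "y \<notin> cthicken (snd s) (fst s)"
    using assms(1) by (auto simp: apart_def)
  then show ?thesis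
  proof cases
    case 1
    then have "\<And>y. y \<in> fst t \<Longrightarrow> 1 / Suc (snd t) < dist x y"
      by (auto simp: cthicken_def dist_commute not_le)
    then show ?thesis
      using ex_uniform_gap[OF assms(3)] 1 unfolding robustly_apart_def by blast
  next
    case 2
    then have "\<And>x. x \<in> fst s \<Longrightarrow> 1 / Suc (snd s) < dist y x"
      by (auto simp: cthicken_def dist_commute not_le)
    then show ?thesis
      using ex_uniform_gap[OF assms(2)] 2 unfolding robustly_apart_def by (metis dist_commute)
  qed
qed

lemma robustly_apart_mono:
  assumes "robustly_apart m s t" "m \<le> m'"
  shows "robustly_apart m' s t"
proof -
  have "1 / real (Suc m') \<le> 1 / real (Suc m)"
    using assms(2) by (simp add: frac_le)
  then have "a + 1 / real (Suc m) \<le> b \<Longrightarrow> a + 1 / real (Suc m') \<le> b" for a b :: real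
    by linarith
  then show ?thesis
    using assms(1) unfolding robustly_apart_def by meson
qed

lemma grid_close:
  assumes "grid m G = grid m G'" "x \<in> G"
  shows "\<exists>x'\<in>G'. dist x x' < 1 / Suc m"
proof -
  obtain x' :: real where x': "x' \<in> G'" "\<lfloor>Suc m * x\<rfloor> = \<lfloor>Suc m * x'\<rfloor>"
    using imageI[OF assms(2), of "\<lambda>x. \<lfloor>Suc m * x\<rfloor>"] assms(1) by (auto simp only: grid_def)
  then have "\<bar>Suc m * x - Suc m * x'\<bar> < 1"
    by linarith
  then have "real (Suc m) * \<bar>x - x'\<bar> < 1"
    by (simp flip: right_diff_distrib abs_mult add: abs_mult)
  then have "dist x x' < 1 / Suc m"
    by (simp add: dist_real_def field_simps)
  then show ?thesis using x' by blast
qed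

text \<open>Equal codes allow \<open>t'\<close> to be exchanged for \<open>t\<close> by moving
  points less than 1/(m+1), which is the margin in \<open>robustly_apart\<close>.\<close>

lemma apart_if_same_grid:
  assumes ra: "robustly_apart m s t'" and gr: "grid m (fst t') = grid m (fst t)" and sn: "snd t' = snd t"
  shows "apart s t"
proof (rule ccontr)
  assume "\<not> apart s t"
  then have s: "fst s \<subseteq> cthicken (snd t) (fst t)" and t: "fst t \<subseteq> cthicken (snd s) (fst s)"
    by (auto simp: apart_def)
  from ra consider x where "x \<in> fst s" "\<forall>y\<in>fst t'. 1 / Suc (snd t') + 1 / Suc m \<le> dist x y"
    | y where "y \<in> fst t'" "\<forall>x\<in>fst s. 1 / Suc (snd s) + 1 / Suc m \<le> dist x y"
    unfolding robustly_apart_def by blast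
  then show False
  proof cases
    case 1
    then obtain y where y: "y \<in> fst t" "dist y x \<le> 1 / Suc (snd t)"
      using s in_cthicken_iff by blast
    then obtain y' where "y' \<in> fst t'" "dist y y' < 1 / Suc m"
      using grid_close[OF gr[symmetric]] by blast
    then show False using 1(2) y(2) sn dist_triangle[of x y' y] by (fastforce simp: dist_commute)
  next
    case 2
    then obtain y' where y': "y' \<in> fst t" "dist y y' < 1 / Suc m"
      using grid_close[OF gr] by blast
    then obtain x where "x \<in> fst s" "dist x y' \<le> 1 / Suc (snd s)"
      using t in_cthicken_iff by blast
    then show False using 2(2) y'(2) dist_triangle[of x y y'] by (fastforce simp: dist_commute)
  qed
qed

lemma finite_ex_uniform_nat:
  assumes "finite S" "\<And>s. s \<in> S \<Longrightarrow> \<exists>n::nat. Q s n" "\<And>s m n. Q s m \<Longrightarrow> m \<le> n \<Longrightarrow> Q s n"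
  shows "\<exists>n. \<forall>s\<in>S. Q s n"
  using assms(1,2)
proof (induction S)
  case (insert x S)
  then obtain n where "\<forall>s\<in>S. Q s n" by auto
  moreover obtain m where "Q x m" using insert.prems by auto
  ultimately have "\<forall>s\<in>insert x S. Q s (max m n)"
    using assms(3) by (metis insert_iff max.cobounded1 max.cobounded2)
  then show ?case ..
qed auto

text \<open>Conditions are finite sets of pairs \<open>(F, n)\<close>, promising the cell of radius \<open>1 / (n + 1)\<close> about \<open>F\<close>.
  Two conditions with the same grid code have a union that is a condition, so the poset is even
  \<open>\<sigma>\<close>-centred.\<close>

lemma normal_space_PR:
  assumes MA: "martins_axiom TYPE(real set)" and small: "Fpow A \<prec> (UNIV :: nat set set)"
  shows "normal_space (PR A)"
  unfolding normal_space_def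
proof (intro allI impI)
  fix H K assume "closedin (PR A) H \<and> closedin (PR A) K \<and> disjnt H K"
  then have cl: "closedin (PR A) H" "closedin (PR A) K" and HK: "H \<inter> K = {}"
    by (auto simp: disjnt_def)
  have sub: "H \<union> K \<subseteq> Fpow A - {{}}"
    using cl closedin_subset topspace_PR by blast
  define opp where "opp = (\<lambda>F G. F \<in> H \<and> G \<in> K \<or> F \<in> K \<and> G \<in> H)"
  \<comment> \<open>The second clause keeps the closed promise about \<open>F\<close> clear of the
    opposite set. Density depends on it: a new opposite point \<open>F\<close> lying in the
    thickening of an old centre cannot contain that centre.\<close>
  define T where "T = {(F, n). F \<in> H \<union> K \<and> (\<forall>G. opp F G \<longrightarrow> \<not> (F \<subseteq> G \<and> G \<subseteq> cthicken n F))}"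
  define P where "P = {p \<in> Fpow T. \<forall>s\<in>p. \<forall>t\<in>p. opp (fst s) (fst t) \<longrightarrow> apart s t}"
  define r where "r = {(p, q). p \<in> P \<and> q \<in> P \<and> q \<subseteq> p}"
  have finT: "finite (fst s)" if "s \<in> T" for s
    using that sub by (auto simp: T_def Fpow_def)
  have opp_sym: "opp F G \<longleftrightarrow> opp G F" for F G
    by (auto simp: opp_def)
  have T_up: "(F, n) \<in> T \<Longrightarrow> n \<le> n' \<Longrightarrow> (F, n') \<in> T" for F n n'
    using cthicken_antimono unfolding T_def by blast
  have T_ex: "\<exists>n. (F, n) \<in> T" if F: "F \<in> H \<union> K" for F
  proof -
    define L where "L = (if F \<in> H then K else H)"
    have "closedin (PR A) L" "F \<notin> L" "\<And>G. opp F G \<Longrightarrow> G \<in> L"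
      using cl HK F by (auto simp: L_def opp_def)
    then obtain m where m: "cell A F m \<subseteq> topspace (PR A) - L"
      using sub F unfolding closedin_def openin_PR_iff topspace_PR by blast
    \<comment> \<open>The successor pays for passing from open to closed thickenings.\<close>
    have "\<not> (F \<subseteq> G \<and> G \<subseteq> cthicken (Suc m) F)" if "opp F G" for G
    proof
      assume "F \<subseteq> G \<and> G \<subseteq> cthicken (Suc m) F"
      moreover have "G \<in> Fpow A - {{}}"
        using that sub by (auto simp: opp_def)
      ultimately have "G \<in> cell A F m"
        using cthicken_subset_thicken[of m "Suc m" F] by (auto simp: cell_def)
      then show False
        using m \<open>\<And>G. opp F G \<Longrightarrow> G \<in> L\<close> that by blast
    qed
    then have "(F, Suc m) \<in> T" using F by (auto simp: T_def)
    then show ?thesis ..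
  qed
  have ccc: "ccc_poset P r"
    unfolding ccc_poset_def
  proof (intro conjI allI impI)
    show "partial_order_on P r"
      by (auto simp: partial_order_on_def preorder_on_def refl_on_def trans_def antisym_def r_def)
    show "P \<noteq> {}"
      by (auto simp: P_def Fpow_def)
    fix \<A> assume \<A>: "\<A> \<subseteq> P" "pairwise (\<lambda>p q. \<not> compatible_in P r p q) \<A>"
    have "\<exists>m. \<forall>st\<in>p \<times> p. opp (fst (fst st)) (fst (snd st)) \<longrightarrow> robustly_apart m (fst st) (snd st)"
      if "p \<in> P" for p
    proof (rule finite_ex_uniform_nat)
      show "finite (p \<times> p)" using that by (auto simp: P_def Fpow_def)
      show "\<exists>m. opp (fst (fst st)) (fst (snd st)) \<longrightarrow> robustly_apart m (fst st) (snd st)" if "st \<in> p \<times> p" for st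
      proof -
        obtain s t where st: "st = (s, t)" by (rule prod.exhaust)
        then have "s \<in> p" "t \<in> p" using that by auto
        then have "opp (fst s) (fst t) \<longrightarrow> apart s t" "finite (fst s)" "finite (fst t)"
          using \<open>p \<in> P\<close> finT unfolding P_def Fpow_def by blast+
        then show ?thesis using robustly_apart_if_apart st by auto
      qed
    qed (auto intro: robustly_apart_mono)
    then obtain m where m: "\<And>p s t. p \<in> P \<Longrightarrow> s \<in> p \<Longrightarrow> t \<in> p \<Longrightarrow> opp (fst s) (fst t) \<Longrightarrow> robustly_apart (m p) s t"
      by (metis SigmaI fst_conv snd_conv)
    \<comment> \<open>The code records the margin, the rounded centres, the radii and the side of
      each centre. The side ensures that the counterpart of an element opposite to \<open>s\<close>
      is again opposite to \<open>s\<close>.\<close>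
    define code where "code = (\<lambda>p. (m p, (\<lambda>s. (grid (m p) (fst s), snd s, fst s \<in> H)) ` p))"
    have compat: "compatible_in P r p q" if pq: "p \<in> P" "q \<in> P" "code p = code q" for p q
    proof -
      \<comment> \<open>The counterpart \<open>t'\<close> of \<open>t\<close> lies in the same
        condition as \<open>s\<close>, so the two are apart with margin \<open>m p\<close>; equal
        grid codes transfer this to \<open>t\<close>.\<close>
      have "apart s t" if st: "s \<in> p" "t \<in> q" "opp (fst s) (fst t)" for s t
      proof -
        have "(grid (m p) (fst t), snd t, fst t \<in> H) \<in> (\<lambda>s. (grid (m p) (fst s), snd s, fst s \<in> H)) ` p"
          using pq(3) st(2) by (auto simp: code_def)
        then obtain t' where t': "t' \<in> p" "grid (m p) (fst t') = grid (m p) (fst t)" "snd t' = snd t"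
          "fst t' \<in> H \<longleftrightarrow> fst t \<in> H"
          by auto
        have "fst t' \<in> H \<union> K" using t'(1) pq(1) by (auto simp: P_def Fpow_def T_def)
        then have "opp (fst s) (fst t')"
          using st(3) t'(4) HK by (auto simp: opp_def)
        then show ?thesis
          using apart_if_same_grid m pq(1) st(1) t' by blast
      qed
      then have "p \<union> q \<in> P"
        using pq opp_sym apart_sym unfolding P_def Fpow_def by blast
      then show ?thesis
        using pq unfolding compatible_in_def r_def by (intro bexI[of _ "p \<union> q"]) auto
    qed
    have "inj_on code \<A>"
      using \<A> compat unfolding inj_on_def pairwise_def by blast
    moreover have "code ` \<A> \<subseteq> UNIV \<times> Fpow (Fpow UNIV \<times> UNIV \<times> UNIV)"
    proof
      fix c assume "c \<in> code ` \<A>"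
      then obtain p where p: "p \<in> P" "c = code p" using \<A>(1) by blast
      then have "finite p" "\<And>s. s \<in> p \<Longrightarrow> finite (fst s)"
        using finT by (auto simp: P_def Fpow_def)
      then show "c \<in> UNIV \<times> Fpow (Fpow UNIV \<times> UNIV \<times> UNIV)"
        unfolding p code_def by (auto simp: Fpow_def grid_def)
    qed
    moreover have "countable (UNIV \<times> Fpow (Fpow UNIV \<times> UNIV \<times> UNIV) :: (nat \<times> (int set \<times> nat \<times> bool) set) set)"
      by (intro countable_SIGMA countable_Fpow) auto
    ultimately show "countable \<A>"
      using countable_image_inj_on countable_subset by blast
  qed
  define D where "D = (\<lambda>F. {p \<in> P. \<exists>n. (F, n) \<in> p})"
  have dense: "dense_in_poset P r X" if "X \<in> D ` (H \<union> K)" for X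
  proof -
    obtain F where F: "F \<in> H \<union> K" "X = D F" using \<open>X \<in> D ` (H \<union> K)\<close> by blast
    have "\<exists>q\<in>D F. (q, p) \<in> r" if p: "p \<in> P" for p
    proof -
      have pT: "p \<subseteq> T" and finp: "finite p" using p by (auto simp: P_def Fpow_def)
      have "\<exists>n. \<forall>t\<in>p. opp F (fst t) \<longrightarrow> apart (F, n) t"
      proof (rule finite_ex_uniform_nat[OF finp])
        fix t assume t: "t \<in> p"
        show "\<exists>n. opp F (fst t) \<longrightarrow> apart (F, n) t"
        proof (cases "opp F (fst t) \<and> F \<subseteq> cthicken (snd t) (fst t)")
          case True
          \<comment> \<open>Membership of \<open>t\<close> in \<open>T\<close> excludes both
            inclusions at once. A point of \<open>fst t\<close> outside \<open>F\<close> thus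
            exists, and a small radius about \<open>F\<close> avoids it.\<close>
          then have "\<not> fst t \<subseteq> F"
            using t pT opp_sym by (force simp: T_def)
          then obtain x where x: "x \<in> fst t" "x \<notin> F" by blast
          have "finite F" using F(1) sub by (auto simp: Fpow_def)
          then obtain n where "x \<notin> thicken n F" using not_in_thicken x(2) by blast
          then have "x \<notin> cthicken (Suc n) F" using cthicken_subset_thicken by blast
          then show ?thesis using x(1) by (auto simp: apart_def)
        qed (auto simp: apart_def)
      qed (auto intro: apart_mono)
      then obtain n where n: "\<forall>t\<in>p. opp F (fst t) \<longrightarrow> apart (F, n) t" ..
      obtain n' where "(F, n') \<in> T" using T_ex F(1) by blast
      define N where "N = max n n'"
      have N: "(F, N) \<in> T" "\<forall>t\<in>p. opp F (fst t) \<longrightarrow> apart (F, N) t"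
        using n \<open>(F, n') \<in> T\<close> apart_mono T_up unfolding N_def by (auto 0 3)
      have "\<not> opp F F" using HK by (auto simp: opp_def)
      then have "insert (F, N) p \<in> P"
        using p N opp_sym apart_sym unfolding P_def Fpow_def by auto
      then show ?thesis using p by (auto simp: D_def r_def)
    qed
    then show ?thesis
      unfolding F(2) dense_in_poset_def by (auto simp: D_def)
  qed
  have few: "D ` (H \<union> K) \<prec> (UNIV :: nat set set)"
  proof -
    have "D ` (H \<union> K) \<lesssim> H \<union> K" by (rule image_lepoll)
    also have "H \<union> K \<lesssim> Fpow A" using sub by (auto intro: subset_imp_lepoll)
    also have "Fpow A \<prec> (UNIV :: nat set set)" by (rule small)
    finally show ?thesis .
  qed
  \<comment> \<open>Coding promises by reals turns conditions into sets of reals, the type at which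
    MA is assumed.\<close>
  obtain e :: "real set \<times> nat \<Rightarrow> real" where e: "inj_on e (Fpow UNIV \<times> UNIV)"
  proof -
    have "Fpow (UNIV :: real set) \<times> (UNIV :: nat set) \<lesssim> (UNIV :: real set)"
      by (intro Times_lepoll_infinite Fpow_lepoll_infinite)
        (auto simp: infinite_UNIV_char_0 simp flip: infinite_le_lepoll)
    then show thesis using that by (auto simp: lepoll_def)
  qed
  have "P \<subseteq> Fpow (Fpow UNIV \<times> UNIV)"
    using finT by (auto simp: P_def Fpow_def)
  then have inj: "inj_on (image e) P"
    using inj_on_image_Fpow[OF e] inj_on_subset by blast
  obtain \<G> where \<G>: "filter_in_poset P r \<G>" "\<And>X. X \<in> D ` (H \<union> K) \<Longrightarrow> \<G> \<inter> X \<noteq> {}"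
    using martins_axiom_transfer[OF MA ccc inj dense few] by blast
  have "\<exists>n. \<exists>p\<in>\<G>. (F, n) \<in> p" if "F \<in> H \<union> K" for F
    using \<G>(2)[of "D F"] that by (auto simp: D_def)
  then obtain n where n: "\<And>F. F \<in> H \<union> K \<Longrightarrow> \<exists>p\<in>\<G>. (F, n F) \<in> p" by metis
  have "disjnt (cell A F (n F)) (cell A G (n G))" if FG: "F \<in> H" "G \<in> K" for F G
  proof -
    obtain p where p: "p \<in> \<G>" "(F, n F) \<in> p" using n[of F] FG by auto
    obtain q where q: "q \<in> \<G>" "(G, n G) \<in> q" using n[of G] FG by auto
    \<comment> \<open>A common extension contains both promises and, being itself a condition, keeps
      them apart.\<close>
    obtain s where "(s, p) \<in> r" "(s, q) \<in> r"
      using \<G>(1) p(1) q(1) unfolding filter_in_poset_def by blast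
    then have s: "s \<in> P" "(F, n F) \<in> s" "(G, n G) \<in> s"
      using p(2) q(2) by (auto simp: r_def)
    have "opp F G" using FG by (simp add: opp_def)
    then have "apart (F, n F) (G, n G)"
      using s by (auto simp: P_def)
    then show ?thesis by (rule disjnt_cells_if_apart)
  qed
  then have "disjnt (\<Union>F\<in>H. cell A F (n F)) (\<Union>G\<in>K. cell A G (n G))"
    by (auto simp: disjnt_iff)
  moreover have "L \<subseteq> (\<Union>F\<in>L. cell A F (n F))" if "L \<subseteq> H \<union> K" for L
    using that sub centre_in_cell by blast
  moreover have "openin (PR A) (\<Union>F\<in>L. cell A F (n F))" for L
    using openin_cell by blast
  ultimately show "\<exists>U V. openin (PR A) U \<and> openin (PR A) V \<and> H \<subseteq> U \<and> K \<subseteq> V \<and> disjnt U V"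
    by (metis Un_upper1 Un_upper2)
qed

lemma normal_PR_not_E_space:
  assumes "martins_axiom TYPE(real set)" "\<not> continuum_hypothesis"
  shows "\<exists>X :: real set topology. normal_space X \<and> Hausdorff_space X \<and> has_uniform_base X \<and> \<not> E_space X"
proof -
  obtain A :: "real set" where A: "uncountable A" "A \<prec> (UNIV :: nat set set)"
    using not_CH_uncountable_subset[OF assms(2)] by blast
  then have "Fpow A \<prec> (UNIV :: nat set set)"
    using Fpow_lepoll_infinite lesspoll_trans1 uncountable_infinite by blast
  then have "normal_space (PR A)"
    by (rule normal_space_PR[OF assms(1)])
  moreover have "Hausdorff_space (PR A)"
    using \<open>normal_space (PR A)\<close> Tychonoff_PR[of A] normal_t1_imp_Hausdorff_space
    by (auto simp: Tychonoff_space_def)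
  ultimately show ?thesis
    using has_uniform_base_PR not_E_space_PR[OF A(1)] by blast
qed

section \<open>Bases of cozero-sets\<close>

lemma zero_set_in_atLeast:
  assumes f: "continuous_map X (top_of_set {0..1::real}) f" and c: "0 < c" "c \<le> 1"
  shows "zero_set_in X {x \<in> topspace X. c \<le> f x}"
proof -
  have "continuous_map X euclideanreal f" and f01: "\<And>x. x \<in> topspace X \<Longrightarrow> f x \<in> {0..1}"
    using f by (auto simp: continuous_map_in_subtopology)
  then have "continuous_map X (top_of_set {0..1}) (\<lambda>x. max 0 (c - f x))"
    using c f01 by (force simp: continuous_map_in_subtopology intro!: continuous_intros)
  moreover have "{x \<in> topspace X. c \<le> f x} = {x \<in> topspace X. max 0 (c - f x) = 0}"
    by (auto simp: max_def)
  ultimately show ?thesis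
    unfolding zero_set_in_def by blast
qed

lemma cozero_set_in_greaterThan:
  assumes f: "continuous_map X (top_of_set {0..1::real}) f" and c: "0 \<le> c"
  shows "cozero_set_in X {x \<in> topspace X. c < f x}"
proof -
  have "continuous_map X euclideanreal f" and f01: "\<And>x. x \<in> topspace X \<Longrightarrow> f x \<in> {0..1}"
    using f by (auto simp: continuous_map_in_subtopology)
  then have "continuous_map X (top_of_set {0..1}) (\<lambda>x. max 0 (f x - c))"
    using c f01 by (force simp: continuous_map_in_subtopology intro!: continuous_intros)
  moreover have "{x \<in> topspace X. c < f x} = topspace X - {x \<in> topspace X. max 0 (f x - c) = 0}"
    by (auto simp: max_def)
  ultimately show ?thesis
    unfolding cozero_set_in_def by blast
qed

lemma openin_cozero_set: "cozero_set_in X V \<Longrightarrow> openin X V"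
proof -
  assume "cozero_set_in X V"
  then obtain f where "continuous_map X (top_of_set {0..1::real}) f" "V = topspace X - {x \<in> topspace X. f x = 0}"
    unfolding cozero_set_in_def by blast
  moreover from this have "closedin X {x \<in> topspace X. f x \<in> {0}}"
    by (intro closedin_continuous_map_preimage[of X euclideanreal]) (auto simp: continuous_map_in_subtopology)
  ultimately show ?thesis
    by auto
qed

lemma openin_complement_zero_set:
  assumes "zero_set_in X Z" shows "openin X (topspace X - Z)"
  using assms openin_cozero_set by (auto simp: zero_set_in_def cozero_set_in_def)

lemma U_representation_cozero_set:
  assumes "cozero_set_in X V"
  shows "\<exists>U. U_representation X V U"
proof -
  obtain f where f: "continuous_map X (top_of_set {0..1::real}) f"
    and V: "V = topspace X - {x \<in> topspace X. f x = 0}"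
    using assms by (auto simp: cozero_set_in_def)
  have f01: "\<And>x. x \<in> topspace X \<Longrightarrow> f x \<in> {0..1}"
    using f by (auto simp: continuous_map_in_subtopology)
  \<comment> \<open>Indices 2j and 2j+1 share the threshold 1/(j+1), first with a strict and then
    with a weak inequality; the next even index lowers it. This gives the inclusions and the
    alternation of cozero-sets and zero-sets.\<close>
  define c where "c = (\<lambda>k::nat. 1 / real (Suc (k div 2)))"
  define U where "U = (\<lambda>k. if even k then {x \<in> topspace X. c k < f x} else {x \<in> topspace X. c k \<le> f x})"
  have cpos: "0 < c k" "c k \<le> 1" for k
    by (auto simp: c_def)
  have "U k \<subseteq> U (k + 1)" for k
  proof (cases "even k")
    case True
    then have "c (k + 1) = c k" by (simp add: c_def)
    then show ?thesis using True by (auto simp: U_def)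
  next
    case False
    then have "c (k + 1) < c k"
      by (auto simp: c_def frac_less2 elim!: oddE)
    then show ?thesis using False by (auto simp: U_def)
  qed
  moreover have "zero_set_in X (U (2 * k - 1))" if "k \<ge> 1" for k
  proof -
    have "odd (2 * k - 1)" using that by simp
    then show ?thesis using zero_set_in_atLeast[OF f cpos] by (simp add: U_def)
  qed
  moreover have "cozero_set_in X (U (2 * k))" for k
    using cozero_set_in_greaterThan[OF f less_imp_le[OF cpos(1)]] by (simp add: U_def)
  moreover have "V = (\<Union>k\<in>{1..}. U k)"
  proof
    show "(\<Union>k\<in>{1..}. U k) \<subseteq> V"
    proof
      fix x assume "x \<in> (\<Union>k\<in>{1..}. U k)"
      then obtain k where "x \<in> U k" by blast
      then have "x \<in> topspace X" "c k \<le> f x" by (auto simp: U_def split: if_splits)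
      then show "x \<in> V" using cpos(1)[of k] by (auto simp: V)
    qed
    show "V \<subseteq> (\<Union>k\<in>{1..}. U k)"
    proof
      fix x assume x: "x \<in> V"
      then have "0 < f x" using f01 by (fastforce simp: V)
      then obtain n where n: "1 / Suc n < f x" using nat_approx_posE by blast
      then have "x \<in> U (2 * n + 1)" using x by (simp add: U_def c_def V)
      then show "x \<in> (\<Union>k\<in>{1..}. U k)" by force
    qed
  qed
  ultimately show ?thesis
    unfolding U_representation_def by blast
qed

lemma openin_base_in: "base_in X \<B> \<Longrightarrow> B \<in> \<B> \<Longrightarrow> openin X B"
  by (simp add: base_in_def arbitrary_union_of_inc)

lemma base_in_nbhd: "base_in X \<B> \<Longrightarrow> openin X W \<Longrightarrow> x \<in> W \<Longrightarrow> \<exists>B\<in>\<B>. x \<in> B \<and> B \<subseteq> W"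
  by (auto simp: base_in_def arbitrary_union_of_alt)

text \<open>Complements of the zero-sets in the representations are open, so adding them to a base
  does not change the generated topology.\<close>

lemma E_space_if_cozero_base:
  assumes t0: "t0_space X" and base: "base_in X \<alpha>" and coz: "\<And>V. V \<in> \<alpha> \<Longrightarrow> cozero_set_in X V"
    and \<sigma>: "sigma_strongly_point_finite \<alpha>"
  shows "E_space X"
proof -
  have "\<forall>V\<in>\<alpha>. \<exists>U. U_representation X V U"
    using U_representation_cozero_set coz by blast
  then obtain U where U: "\<And>V. V \<in> \<alpha> \<Longrightarrow> U_representation X V (U V)"
    by metis
  define S where "S = \<alpha> \<union> {topspace X - U V (2 * k - 1) |V k. V \<in> \<alpha> \<and> k \<ge> 1}"
  have op: "openin X V" if V: "V \<in> S" for V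
  proof (cases "V \<in> \<alpha>")
    case False
    then obtain V' k where V': "V = topspace X - U V' (2 * k - 1)" "V' \<in> \<alpha>" "k \<ge> 1"
      using V unfolding S_def by blast
    then have "zero_set_in X (U V' (2 * k - 1))"
      using U[of V'] unfolding U_representation_def by blast
    then show ?thesis
      unfolding V'(1) by (rule openin_complement_zero_set)
  qed (use base openin_base_in in blast)
  have "openin X W \<longleftrightarrow>
      (arbitrary union_of (finite intersection_of (\<lambda>V. V \<in> S) relative_to topspace X)) W" for W
  proof
    assume W: "openin X W"
    show "(arbitrary union_of (finite intersection_of (\<lambda>V. V \<in> S) relative_to topspace X)) W"
      unfolding arbitrary_union_of_alt
    proof
      fix x assume "x \<in> W"
      then obtain V where V: "V \<in> \<alpha>" "x \<in> V" "V \<subseteq> W" using base_in_nbhd[OF base W] by blast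
      have "(finite intersection_of (\<lambda>V. V \<in> S) relative_to topspace X) (topspace X \<inter> V)"
        using V by (simp add: S_def finite_intersection_of_inc relative_to_inc)
      moreover have "topspace X \<inter> V = V"
        using openin_subset[OF openin_base_in[OF base V(1)]] by blast
      ultimately show "\<exists>V. (finite intersection_of (\<lambda>V. V \<in> S) relative_to topspace X) V \<and> x \<in> V \<and> V \<subseteq> W"
        using V by auto
    qed
  next
    assume "(arbitrary union_of (finite intersection_of (\<lambda>V. V \<in> S) relative_to topspace X)) W"
    then obtain \<W> where \<W>: "W = \<Union>\<W>" "\<And>Y. Y \<in> \<W> \<Longrightarrow> (finite intersection_of (\<lambda>V. V \<in> S) relative_to topspace X) Y"
      by (auto simp: union_of_def)
    have "openin X Y" if Y: "Y \<in> \<W>" for Y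
    proof -
      obtain \<T> where "finite \<T>" "\<T> \<subseteq> S" "Y = topspace X \<inter> \<Inter>\<T>"
        using \<W>(2)[OF Y] by (auto simp: relative_to_def intersection_of_def)
      then show ?thesis
        using openin_Int_Inter[of \<T> X "topspace X"] op by auto
    qed
    then show "openin X W" using \<W>(1) by auto
  qed
  moreover have "S \<subseteq> Pow (topspace X)"
    using op openin_subset by blast
  ultimately have "subbase_in X S"
    unfolding subbase_in_def by blast
  then have "almost_subbase_in X \<alpha>"
    unfolding almost_subbase_in_def S_def using U by blast
  then show ?thesis
    using t0 \<sigma> by (auto simp: E_space_def)
qed

text \<open>Urysohn functions that vanish off \<open>W\<close> and equal 1 on the closed pieces of
  \<open>W\<close> are summed with weights of total 1. The convergence is uniform, and the sum is
  positive exactly on \<open>W\<close>.\<close>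

lemma cozero_set_in_normal_fsigma:
  assumes "normal_space X" "openin X W" "fsigma_in X W"
  shows "cozero_set_in X W"
proof -
  obtain C where C: "\<And>n::nat. closedin X (C n)" "\<Union>(range C) = W"
    using assms(3) by (auto simp: fsigma_in_ascending)
  have "\<exists>f. continuous_map X (top_of_set {0..1::real}) f \<and> f ` (topspace X - W) \<subseteq> {0} \<and> f ` C n \<subseteq> {1}" for n
  proof -
    have "closedin X (topspace X - W)" "disjnt (topspace X - W) (C n)"
      using assms(2) C by (auto simp: disjnt_def)
    then show ?thesis
      using Urysohn_lemma[OF assms(1) _ C(1)[of n], of "topspace X - W" 0 1] by (metis zero_le_one)
  qed
  then obtain f where f: "\<And>n. continuous_map X (top_of_set {0..1::real}) (f n)"
    and f0: "\<And>n x. x \<in> topspace X - W \<Longrightarrow> f n x = 0" and f1: "\<And>n x. x \<in> C n \<Longrightarrow> f n x = 1"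
    by (metis image_subset_iff singletonD)
  have cont: "continuous_map X euclideanreal (f n)" and f01: "\<And>x. x \<in> topspace X \<Longrightarrow> f n x \<in> {0..1}" for n
    using f by (auto simp: continuous_map_in_subtopology Pi_iff)
  define g where "g = (\<lambda>n x. (1/2) ^ Suc n * f n x)"
  have g_nonneg: "0 \<le> g n x" and g_le: "g n x \<le> (1/2) ^ Suc n" if "x \<in> topspace X" for n x
    using f01[OF that, of n] by (auto simp: g_def mult_le_one)
  have half: "(\<lambda>n. (1/2::real) ^ Suc n) sums 1"
    using power_half_series .
  have summable: "summable (\<lambda>n. g n x)" if "x \<in> topspace X" for x
  proof (rule summable_comparison_test')
    show "summable (\<lambda>n. (1/2::real) ^ Suc n)" using half by (rule sums_summable)
    show "norm (g n x) \<le> (1/2) ^ Suc n" for n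
      using g_nonneg[OF that, of n] g_le[OF that, of n] by simp
  qed
  define h where "h = (\<lambda>x. \<Sum>n. g n x)"
  have ul: "uniform_limit (topspace X) (\<lambda>n x. \<Sum>i<n. g i x) h sequentially"
    unfolding h_def using g_nonneg g_le half
    by (intro Weierstrass_m_test[where M = "\<lambda>n. (1/2) ^ Suc n"]) (auto simp: sums_iff)
  have "continuous_map X Met_TC.mtopology h"
  proof (rule Met_TC.continuous_map_uniform_limit_alt[where F = sequentially and f = "\<lambda>n x. \<Sum>i<n. g i x"])
    show "\<forall>\<^sub>F n in sequentially. continuous_map X Met_TC.mtopology (\<lambda>x. \<Sum>i<n. g i x)"
      unfolding mtopology_is_euclidean g_def
      by (intro always_eventually allI continuous_intros continuous_map_real_mult cont) auto
    show "\<forall>\<^sub>F n in sequentially. \<forall>x\<in>topspace X. dist (\<Sum>i<n. g i x) (h x) < \<epsilon>" if "\<epsilon> > 0" for \<epsilon>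
      using uniform_limitD[OF ul that] .
  qed auto
  moreover have "h x \<in> {0..1}" if "x \<in> topspace X" for x
    using suminf_nonneg[OF summable[OF that] g_nonneg[OF that]]
      suminf_le[OF g_le[OF that] summable[OF that]] half by (auto simp: h_def sums_iff)
  ultimately have "continuous_map X (top_of_set {0..1}) h"
    by (auto simp: continuous_map_in_subtopology mtopology_is_euclidean)
  moreover have "W = topspace X - {x \<in> topspace X. h x = 0}"
  proof -
    have "h x = 0" if "x \<in> topspace X - W" for x
      using f0[OF that] by (simp add: h_def g_def)
    moreover have "h x \<noteq> 0" if xW: "x \<in> W" for x
    proof -
      obtain n where "x \<in> C n" using xW C(2) by blast
      moreover have x: "x \<in> topspace X" using xW assms(2) openin_subset by blast
      ultimately have "0 < h x"
        unfolding h_def using f1 by (intro suminf_pos2[OF summable[OF x] g_nonneg[OF x], of n]) (simp add: g_def)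
      then show ?thesis by simp
    qed
    ultimately show ?thesis
      using assms(2) openin_subset by blast
  qed
  ultimately show ?thesis
    unfolding cozero_set_in_def by blast
qed

lemma strongly_point_finite_disjoint:
  assumes "pairwise disjnt \<V>"
  shows "strongly_point_finite \<V>"
  unfolding strongly_point_finite_def
proof (intro allI impI)
  fix \<beta> assume \<beta>: "\<beta> \<subseteq> \<V>" "countable \<beta> \<and> infinite \<beta>"
  then obtain V W where "V \<in> \<beta>" "W \<in> \<beta>" "V \<noteq> W"
    by (metis finite.emptyI finite.insertI finite_subset insertCI subsetI)
  then show "\<exists>\<gamma>\<subseteq>\<beta>. finite \<gamma> \<and> \<gamma> \<noteq> {} \<and> \<Inter>\<gamma> = {}"
    using assms \<beta>(1) by (intro exI[of _ "{V, W}"]) (auto simp: pairwise_def disjnt_def)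
qed

section \<open>Uniform bases\<close>

locale t1_uniform_base =
  fixes X :: "'a topology" and \<B> :: "'a set set"
  assumes t1: "t1_space X" and uniform: "uniform_base_in X \<B>"
begin

lemma base: "base_in X \<B>"
  using uniform by (simp add: uniform_base_in_def)

lemma infinite_base_at:
  "x \<in> topspace X \<Longrightarrow> \<C> \<subseteq> \<B> \<Longrightarrow> infinite \<C> \<Longrightarrow> (\<And>C. C \<in> \<C> \<Longrightarrow> x \<in> C) \<Longrightarrow> base_at X x \<C>"
  using uniform by (simp add: uniform_base_in_def)

text \<open>If infinitely many base members contain \<open>x\<close>, any countably infinite choice
  of them is a local base; otherwise the finitely many that do form one.\<close>

lemma first_countable:
  assumes x: "x \<in> topspace X"
  shows "\<exists>N::nat \<Rightarrow> 'a set. decseq N \<and> (\<forall>n. openin X (N n) \<and> x \<in> N n) \<and>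
           (\<forall>W. openin X W \<and> x \<in> W \<longrightarrow> (\<exists>n. N n \<subseteq> W))"
proof -
  have "\<exists>\<C>. countable \<C> \<and> \<C> \<noteq> {} \<and> base_at X x \<C>"
  proof (cases "finite {B \<in> \<B>. x \<in> B}")
    case True
    have "base_at X x {B \<in> \<B>. x \<in> B}"
      using base_in_nbhd[OF base] openin_base_in[OF base] unfolding base_at_def by blast
    moreover have "{B \<in> \<B>. x \<in> B} \<noteq> {}"
      using base_in_nbhd[OF base openin_topspace x] by blast
    ultimately show ?thesis using True countable_finite by blast
  next
    case False
    then obtain \<C> where \<C>: "\<C> \<subseteq> {B \<in> \<B>. x \<in> B}" "countable \<C>" "infinite \<C>"
      using infinite_countable_subset' by blast
    then have "base_at X x \<C>" using x by (intro infinite_base_at) auto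
    then show ?thesis using \<C> by (metis finite.emptyI)
  qed
  then obtain \<C> where \<C>: "countable \<C>" "\<C> \<noteq> {}" "base_at X x \<C>" by blast
  define N where "N = (\<lambda>n. \<Inter>i\<le>n. from_nat_into \<C> i)"
  have mem: "from_nat_into \<C> i \<in> \<C>" for i using \<C>(2) by (rule from_nat_into)
  have "decseq N"
    unfolding N_def decseq_def by (meson INF_superset_mono atMost_subset_iff order_refl)
  moreover have "openin X (N n) \<and> x \<in> N n" for n
  proof
    show "openin X (N n)"
      unfolding N_def using mem \<C>(3) by (intro openin_INT2) (auto simp: base_at_def)
    show "x \<in> N n"
      using mem \<C>(3) by (auto simp: N_def base_at_def)
  qed
  moreover have "\<exists>n. N n \<subseteq> W" if W: "openin X W" "x \<in> W" for W
  proof -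
    obtain C where C: "C \<in> \<C>" "C \<subseteq> W" using W \<C>(3) by (auto simp: base_at_def)
    then obtain n where "C = from_nat_into \<C> n" using \<C>(1) by (metis from_nat_into_surj)
    then have "N n \<subseteq> W" using C by (auto simp: N_def)
    then show ?thesis ..
  qed
  ultimately show ?thesis by blast
qed

section \<open>Ranks and point-finite layers of a uniform base\<close>

definition isolated :: "'a set" where
  "isolated = {x \<in> topspace X. openin X {x}}"

text \<open>Two distinct points are what the T_1 argument for finite rank uses. Without them
  \<open>card\<close> could meet an infinite set, where it is 0: the empty set may lie below
  infinitely many members.\<close>

definition \<B>\<^sub>2 :: "'a set set" where
  "\<B>\<^sub>2 = {B \<in> \<B>. \<exists>x\<in>B. \<exists>y\<in>B. x \<noteq> y}"

definition rank :: "'a set \<Rightarrow> nat" where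
  "rank B = card {C \<in> \<B>. B \<subset> C}"

definition members :: "nat \<Rightarrow> 'a \<Rightarrow> 'a set set" where
  "members n x = {B \<in> \<B>\<^sub>2. x \<in> B \<and> rank B \<le> n}"

lemma openin_\<B>\<^sub>2: "B \<in> \<B>\<^sub>2 \<Longrightarrow> openin X B"
  using openin_base_in[OF base] by (simp add: \<B>\<^sub>2_def)

lemma \<B>\<^sub>2_nbhd:
  assumes "openin X W" "x \<in> W" "x \<notin> isolated"
  shows "\<exists>B\<in>\<B>\<^sub>2. x \<in> B \<and> B \<subseteq> W"
proof -
  obtain B where B: "B \<in> \<B>" "x \<in> B" "B \<subseteq> W"
    using base_in_nbhd[OF base] assms by blast
  have "x \<in> topspace X" using assms(1,2) openin_subset by blast
  then have "B \<noteq> {x}"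
    using openin_base_in[OF base B(1)] assms(3) by (auto simp: isolated_def)
  then show ?thesis using B by (auto simp: \<B>\<^sub>2_def)
qed

text \<open>Infinitely many supersets of \<open>B\<close> would form a local base at a point
  \<open>x\<close> of \<open>B\<close>, yet all of them contain a second point \<open>y\<close> that
  some neighbourhood of \<open>x\<close> avoids.\<close>

lemma finite_strict_supersets:
  assumes "B \<in> \<B>\<^sub>2"
  shows "finite {C \<in> \<B>. B \<subset> C}"
proof (rule ccontr)
  assume inf: "infinite {C \<in> \<B>. B \<subset> C}"
  obtain x y where xy: "x \<in> B" "y \<in> B" "x \<noteq> y" using assms by (auto simp: \<B>\<^sub>2_def)
  then have top: "x \<in> topspace X" "y \<in> topspace X"
    using openin_\<B>\<^sub>2[OF assms] openin_subset by blast+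
  then have "base_at X x {C \<in> \<B>. B \<subset> C}"
    using inf xy by (intro infinite_base_at) auto
  moreover obtain W where "openin X W" "x \<in> W" "y \<notin> W"
    using t1 top xy unfolding t1_space_def by blast
  ultimately obtain C where "B \<subset> C" "C \<subseteq> W" unfolding base_at_def by blast
  then show False using xy \<open>y \<notin> W\<close> by blast
qed

text \<open>An infinite family of members containing \<open>x\<close> has no minimal element, and ranks increase
  strictly along descending chains.\<close>

lemma finite_members:
  assumes x: "x \<in> topspace X"
  shows "finite (members n x)"
proof (rule ccontr)
  assume inf: "infinite (members n x)"
  then obtain B where "B \<in> members n x" by (metis ex_in_conv finite.emptyI)
  moreover have "\<forall>B. B \<in> members n x \<longrightarrow> rank B \<le> n" by (auto simp: members_def)
  ultimately obtain B where B: "B \<in> members n x" "\<And>C. C \<in> members n x \<Longrightarrow> rank C \<le> rank B"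
    using ex_has_greatest_nat[of "\<lambda>B. B \<in> members n x" B rank "Suc n"] by (metis less_Suc_eq_le)
  \<comment> \<open>Removing \<open>B\<close> keeps the family infinite and makes the inclusion
    obtained below strict.\<close>
  have "base_at X x (members n x - {B})"
    using inf x by (intro infinite_base_at) (auto simp: members_def \<B>\<^sub>2_def)
  moreover have "openin X B" "x \<in> B"
    using B(1) openin_\<B>\<^sub>2 by (auto simp: members_def)
  ultimately obtain C where C: "C \<in> members n x" "C \<subset> B"
    unfolding base_at_def by blast
  have "insert B {D \<in> \<B>. B \<subset> D} \<subseteq> {D \<in> \<B>. C \<subset> D}"
    using B(1) C(2) by (auto simp: members_def \<B>\<^sub>2_def)
  moreover have "finite {D \<in> \<B>. C \<subset> D}"
    using C(1) finite_strict_supersets by (auto simp: members_def)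
  ultimately have "card (insert B {D \<in> \<B>. B \<subset> D}) \<le> rank C"
    unfolding rank_def by (rule card_mono[rotated])
  moreover have "finite {D \<in> \<B>. B \<subset> D}"
    using B(1) finite_strict_supersets by (auto simp: members_def)
  ultimately have "Suc (rank B) \<le> rank C"
    by (simp add: rank_def)
  then show False using B(2)[OF C(1)] by simp
qed

text \<open>Otherwise the intersection of these members would be open, and by T_1 it would be
  \<open>{x}\<close>.\<close>

lemma infinite_\<B>\<^sub>2_at:
  assumes x: "x \<in> topspace X" "x \<notin> isolated"
  shows "infinite {B \<in> \<B>\<^sub>2. x \<in> B}"
proof
  assume fin: "finite {B \<in> \<B>\<^sub>2. x \<in> B}"
  have "openin X (topspace X \<inter> \<Inter>{B \<in> \<B>\<^sub>2. x \<in> B})"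
    using fin openin_\<B>\<^sub>2 by (intro openin_Int_Inter) auto
  moreover have "topspace X \<inter> \<Inter>{B \<in> \<B>\<^sub>2. x \<in> B} = {x}"
  proof -
    have "\<exists>B\<in>\<B>\<^sub>2. x \<in> B \<and> y \<notin> B" if y: "y \<in> topspace X" "y \<noteq> x" for y
    proof -
      obtain W where "openin X W" "x \<in> W" "y \<notin> W"
        using t1 x y unfolding t1_space_def by metis
      then show ?thesis using \<B>\<^sub>2_nbhd x(2) by blast
    qed
    then show ?thesis using x(1) by blast
  qed
  ultimately show False using x by (simp add: isolated_def)
qed

text \<open>A point of \<open>W\<close> lies in finitely many members that leave \<open>W\<close>,
  so it escapes \<open>R n\<close> for large \<open>n\<close>. A non-isolated point outside
  \<open>W\<close> lies in members of arbitrarily high rank, all of which leave \<open>W\<close>;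
  isolated points outside \<open>W\<close> are put into \<open>R n\<close> directly.\<close>

lemma fsigma_in_openin:
  assumes W: "openin X W"
  shows "fsigma_in X W"
proof -
  define R where "R = (\<lambda>n. \<Union>{B \<in> \<B>\<^sub>2. n \<le> rank B \<and> \<not> B \<subseteq> W} \<union> (\<Union>x\<in>isolated - W. {x}))"
  have WX: "W \<subseteq> topspace X" using W openin_subset by blast
  have "openin X (R n)" for n
    unfolding R_def using openin_\<B>\<^sub>2 by (intro openin_Un openin_Union) (auto simp: isolated_def)
  then have "closedin X (topspace X - R n)" for n
    by blast
  moreover have "W = (\<Union>n. topspace X - R n)"
  proof (intro equalityI subsetI)
    fix x assume x: "x \<in> W"
    have "finite {B \<in> \<B>\<^sub>2. x \<in> B \<and> \<not> B \<subseteq> W}"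
    proof (rule ccontr)
      assume "infinite {B \<in> \<B>\<^sub>2. x \<in> B \<and> \<not> B \<subseteq> W}"
      then have "base_at X x {B \<in> \<B>\<^sub>2. x \<in> B \<and> \<not> B \<subseteq> W}"
        using x WX by (intro infinite_base_at) (auto simp: \<B>\<^sub>2_def)
      then show False using W x unfolding base_at_def by blast
    qed
    then have "finite (rank ` {B \<in> \<B>\<^sub>2. x \<in> B \<and> \<not> B \<subseteq> W})"
      by (rule finite_imageI)
    then obtain n where "\<forall>m\<in>rank ` {B \<in> \<B>\<^sub>2. x \<in> B \<and> \<not> B \<subseteq> W}. m < n"
      using finite_nat_set_iff_bounded by metis
    then have "\<And>B. B \<in> \<B>\<^sub>2 \<Longrightarrow> x \<in> B \<Longrightarrow> \<not> B \<subseteq> W \<Longrightarrow> rank B < n"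
      by blast
    then have "x \<notin> R n" using x by (force simp: R_def not_le)
    then show "x \<in> (\<Union>n. topspace X - R n)" using x WX by blast
  next
    fix x assume "x \<in> (\<Union>n. topspace X - R n)"
    then obtain n where x: "x \<in> topspace X" "x \<notin> R n" by blast
    show "x \<in> W"
    proof (rule ccontr)
      assume xW: "x \<notin> W"
      then have "x \<notin> isolated" using x(2) by (auto simp: R_def)
      then have "\<not> {B \<in> \<B>\<^sub>2. x \<in> B} \<subseteq> members n x"
        using infinite_\<B>\<^sub>2_at finite_members x(1) finite_subset by metis
      then obtain B where "B \<in> \<B>\<^sub>2" "x \<in> B" "n \<le> rank B" by (force simp: members_def)
      then show False using x(2) xW by (auto simp: R_def)
    qed
  qed
  ultimately show ?thesis
    using fsigma_in_Union[of "range (\<lambda>n. topspace X - R n)" X] closed_imp_fsigma_in by auto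
qed

lemma openin_members_supset:
  assumes x: "x \<in> topspace X"
  shows "openin X {y \<in> topspace X. members n x \<subseteq> members n y}"
proof -
  have "{y \<in> topspace X. members n x \<subseteq> members n y} = topspace X \<inter> \<Inter>(members n x)"
    by (auto simp: members_def)
  moreover have "openin X (topspace X \<inter> \<Inter>(members n x))"
    using finite_members[OF x] openin_\<B>\<^sub>2 by (intro openin_Int_Inter) (auto simp: members_def)
  ultimately show ?thesis by simp
qed

lemma openin_card_members_ge: "openin X {x \<in> topspace X. k \<le> card (members n x)}"
proof (subst openin_subopen, intro ballI)
  fix x assume x: "x \<in> {x \<in> topspace X. k \<le> card (members n x)}"
  have "card (members n x) \<le> card (members n y)" if "y \<in> topspace X" "members n x \<subseteq> members n y" for y
    using that finite_members by (simp add: card_mono)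
  then have "{y \<in> topspace X. members n x \<subseteq> members n y} \<subseteq> {x \<in> topspace X. k \<le> card (members n x)}"
    using x by force
  then show "\<exists>T. openin X T \<and> x \<in> T \<and> T \<subseteq> {x \<in> topspace X. k \<le> card (members n x)}"
    using x openin_members_supset[of x n] by blast
qed

text \<open>The layer is the intersection of an open set, which is F_sigma here, with a closed set.
  Its closed pieces are where the discrete families live.\<close>

lemma fsigma_in_card_members: "fsigma_in X {x \<in> topspace X. card (members n x) = k}"
proof -
  have "{x \<in> topspace X. card (members n x) = k} =
      {x \<in> topspace X. k \<le> card (members n x)} \<inter> (topspace X - {x \<in> topspace X. Suc k \<le> card (members n x)})"
    by auto
  moreover have "fsigma_in X {x \<in> topspace X. k \<le> card (members n x)}"
    by (simp add: fsigma_in_openin openin_card_members_ge)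
  moreover have "closedin X (topspace X - {x \<in> topspace X. Suc k \<le> card (members n x)})"
    using openin_card_members_ge by blast
  ultimately show ?thesis
    by (simp only: fsigma_in_Int closed_imp_fsigma_in)
qed

text \<open>A point of \<open>C\<close> near \<open>y \<in> C\<close> lies in all members containing \<open>y\<close>, hence in exactly those, as both
  lie in \<open>k\<close> members.\<close>

lemma closedin_Union_members_classes:
  assumes C: "closedin X C" "\<And>x. x \<in> C \<Longrightarrow> card (members n x) = k"
  shows "closedin X {x \<in> C. members n x \<in> \<T>}"
proof -
  have CX: "C \<subseteq> topspace X" using C(1) closedin_subset by blast
  have "openin X (topspace X - {x \<in> C. members n x \<in> \<T>})"
  proof (subst openin_subopen, intro ballI)
    fix y assume y: "y \<in> topspace X - {x \<in> C. members n x \<in> \<T>}"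
    show "\<exists>N. openin X N \<and> y \<in> N \<and> N \<subseteq> topspace X - {x \<in> C. members n x \<in> \<T>}"
    proof (cases "y \<in> C")
      case True
      define N where "N = {z \<in> topspace X. members n y \<subseteq> members n z}"
      have same: "members n z = members n y" if "z \<in> N" "z \<in> C" for z
        using card_subset_eq[of "members n z" "members n y"] that True C(2) CX finite_members
        by (auto simp: N_def)
      then have "N \<subseteq> topspace X - {x \<in> C. members n x \<in> \<T>}"
      proof (intro subsetI DiffI notI)
        fix z assume "z \<in> N" "z \<in> {x \<in> C. members n x \<in> \<T>}"
        then show False using y True same[of z] by simp
      qed (simp add: N_def)
      moreover have "openin X N" "y \<in> N"
        using y openin_members_supset by (auto simp: N_def)
      ultimately show ?thesis by blast
    next
      case False
      then show ?thesis using C(1) y by (intro exI[of _ "topspace X - C"]) auto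
    qed
  qed
  then show ?thesis using CX by (auto simp: closedin_def)
qed

end

section \<open>Separation of discrete families\<close>

text \<open>For closed sets this is the usual discreteness: removing the union of all members that
  miss a given point leaves a neighbourhood of it meeting at most one member.\<close>

definition discrete_closed_family :: "'a topology \<Rightarrow> 'a set set \<Rightarrow> bool" where
  "discrete_closed_family X \<F> \<longleftrightarrow> pairwise disjnt \<F> \<and> (\<forall>\<G>\<subseteq>\<F>. closedin X (\<Union>\<G>))"

lemma prob_space_coin_product: "prob_space (coin_product K)"
  unfolding coin_product_def by (intro prob_space_PiM prob_space_uniform_count_measure) auto

lemma coin_product_differ:
  assumes "i \<in> K" "j \<in> K" "i \<noteq> j"
  shows "{f \<in> space (coin_product K). f i \<and> \<not> f j} \<in> sets (coin_product K)"
    and "emeasure (coin_product K) {f \<in> space (coin_product K). f i \<and> \<not> f j} = ennreal (1/4)"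
proof -
  let ?M = "\<lambda>_. uniform_count_measure (UNIV :: bool set)"
  let ?A = "\<lambda>k. if k = i then {True} else {False}"
  have eq: "{f \<in> space (coin_product K). f i \<and> \<not> f j} = prod_emb K ?M {i, j} (Pi\<^sub>E {i, j} ?A)"
    using assms unfolding coin_product_def
    by (auto simp: prod_emb_def space_PiM space_uniform_count_measure PiE_iff extensional_def)
  show "{f \<in> space (coin_product K). f i \<and> \<not> f j} \<in> sets (coin_product K)"
    unfolding eq unfolding coin_product_def using assms
    by (intro sets_PiM_I) (auto simp: sets_uniform_count_measure)
  have "emeasure (PiM K ?M) (prod_emb K ?M {i, j} (Pi\<^sub>E {i, j} ?A)) = (\<Prod>k\<in>{i, j}. emeasure (?M k) (?A k))"
    using assms by (intro emeasure_PiM_emb prob_space_uniform_count_measure) (auto simp: sets_uniform_count_measure)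
  also have "\<dots> = ennreal (1/2) * ennreal (1/2)"
    using assms by (simp add: emeasure_uniform_count_measure inverse_eq_divide del: ennreal_half)
  also have "\<dots> = ennreal (1/4)"
    by (subst ennreal_mult[symmetric]) auto
  finally show "emeasure (coin_product K) {f \<in> space (coin_product K). f i \<and> \<not> f j} = ennreal (1/4)"
    unfolding eq by (simp add: coin_product_def)
qed

text \<open>Nyikos' argument: separate the two halves of the family selected by each \<open>f\<close>, and give \<open>x\<close> a
  neighbourhood that is small enough for all \<open>f\<close> outside a set of measure less than \<open>1/8\<close>. For two
  members of the family, some \<open>f\<close> that tells them apart is good for both points.\<close>

lemma PMEA_separates_discrete_family:
  fixes X :: "'a topology"
  assumes PMEA: "PMEA TYPE('a)" and normal: "normal_space X"
    and fc: "\<And>x. x \<in> topspace X \<Longrightarrow> \<exists>N::nat \<Rightarrow> 'a set. decseq N \<and> (\<forall>n. openin X (N n) \<and> x \<in> N n) \<and>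
           (\<forall>W. openin X W \<and> x \<in> W \<longrightarrow> (\<exists>n. N n \<subseteq> W))"
    and discrete: "discrete_closed_family X \<F>" and ne: "{} \<notin> \<F>"
  obtains O' where "\<And>F. F \<in> \<F> \<Longrightarrow> openin X (O' F) \<and> F \<subseteq> O' F"
    "\<And>F G. F \<in> \<F> \<Longrightarrow> G \<in> \<F> \<Longrightarrow> F \<noteq> G \<Longrightarrow> disjnt (O' F) (O' G)"
proof -
  \<comment> \<open>Coins are indexed by points of \<open>X\<close>, as PMEA is assumed for that
    type; disjointness makes the representatives distinct.\<close>
  define rep where "rep = (\<lambda>F::'a set. SOME x. x \<in> F)"
  have rep: "rep F \<in> F" if "F \<in> \<F>" for F
    using that ne unfolding rep_def by (metis ex_in_conv someI_ex)
  have disj: "F \<inter> G = {}" if "F \<in> \<F>" "G \<in> \<F>" "F \<noteq> G" for F G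
    using discrete that by (auto simp: discrete_closed_family_def pairwise_def disjnt_def)
  have rep_inj: "rep F \<noteq> rep G" if "F \<in> \<F>" "G \<in> \<F>" "F \<noteq> G" for F G
    using rep that disj by (metis IntI empty_iff)
  define K where "K = rep ` \<F>"
  obtain \<nu> where \<nu>: "space \<nu> = space (coin_product K)" "sets \<nu> = Pow (space (coin_product K))"
    "\<And>A. A \<in> sets (coin_product K) \<Longrightarrow> emeasure \<nu> A = emeasure (coin_product K) A"
    using PMEA unfolding PMEA_def by metis
  define \<Omega> where "\<Omega> = space (coin_product K)"
  have "emeasure \<nu> (space \<nu>) = 1"
    using \<nu> prob_space.emeasure_space_1[OF prob_space_coin_product] by simp
  then interpret prob_space \<nu> by (rule prob_spaceI)
  have sets: "A \<in> events" if "A \<subseteq> \<Omega>" for A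
    using that \<nu> by (simp add: \<Omega>_def)
  have "\<exists>U V. openin X U \<and> openin X V \<and> \<Union>{F \<in> \<F>. f (rep F)} \<subseteq> U \<and> \<Union>{F \<in> \<F>. \<not> f (rep F)} \<subseteq> V \<and> disjnt U V" for f
  proof -
    have "closedin X (\<Union>{F \<in> \<F>. f (rep F)})" "closedin X (\<Union>{F \<in> \<F>. \<not> f (rep F)})"
      using discrete by (auto simp: discrete_closed_family_def)
    moreover have "disjnt (\<Union>{F \<in> \<F>. f (rep F)}) (\<Union>{F \<in> \<F>. \<not> f (rep F)})"
      using disj unfolding disjnt_def by blast
    ultimately show ?thesis using normal unfolding normal_space_def by blast
  qed
  then have "\<forall>f. \<exists>UV. openin X (fst UV) \<and> openin X (snd UV) \<and> \<Union>{F \<in> \<F>. f (rep F)} \<subseteq> fst UV \<and>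
      \<Union>{F \<in> \<F>. \<not> f (rep F)} \<subseteq> snd UV \<and> disjnt (fst UV) (snd UV)"
    by simp
  from choice[OF this] obtain UV where UV: "\<And>f. openin X (fst (UV f)) \<and> openin X (snd (UV f)) \<and>
      \<Union>{F \<in> \<F>. f (rep F)} \<subseteq> fst (UV f) \<and> \<Union>{F \<in> \<F>. \<not> f (rep F)} \<subseteq> snd (UV f) \<and> disjnt (fst (UV f)) (snd (UV f))"
    by blast
  define U where "U = (\<lambda>f. fst (UV f))"
  define V where "V = (\<lambda>f. snd (UV f))"
  have UV: "\<And>f. openin X (U f)" "\<And>f. openin X (V f)" "\<And>f. disjnt (U f) (V f)"
    "\<And>f F. F \<in> \<F> \<Longrightarrow> f (rep F) \<Longrightarrow> F \<subseteq> U f" "\<And>f F. F \<in> \<F> \<Longrightarrow> \<not> f (rep F) \<Longrightarrow> F \<subseteq> V f"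
    unfolding U_def V_def using UV by (simp_all add: Sup_le_iff)
  have FX: "F \<subseteq> topspace X" if "F \<in> \<F>" for F
  proof -
    have "{F} \<subseteq> \<F>" using that by blast
    then have "closedin X (\<Union>{F})"
      using discrete unfolding discrete_closed_family_def by metis
    then show ?thesis using closedin_subset by auto
  qed
  obtain N :: "'a \<Rightarrow> nat \<Rightarrow> 'a set" where N: "\<And>x. x \<in> topspace X \<Longrightarrow> decseq (N x)"
    "\<And>x n. x \<in> topspace X \<Longrightarrow> openin X (N x n) \<and> x \<in> N x n"
    "\<And>x W. x \<in> topspace X \<Longrightarrow> openin X W \<Longrightarrow> x \<in> W \<Longrightarrow> \<exists>n. N x n \<subseteq> W"
    using fc by metis
  \<comment> \<open>The choices \<open>f\<close> for which the n-th neighbourhood of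
    \<open>x\<close> already lies in the open set on the side assigned to \<open>F\<close>.\<close>
  define Q where "Q = (\<lambda>F x n. {f \<in> \<Omega>. if f (rep F) then N x n \<subseteq> U f else N x n \<subseteq> V f})"
  have "\<exists>n. prob (Q F x n) > 7/8" if F: "F \<in> \<F>" and x: "x \<in> F" for F x
  proof -
    have xX: "x \<in> topspace X" using F x FX by blast
    have "incseq (Q F x)"
      using N(1)[OF xX] unfolding incseq_def decseq_def Q_def by (simp add: subset_iff)
    moreover have "(\<Union>n. Q F x n) = space \<nu>"
    proof
      show "space \<nu> \<subseteq> (\<Union>n. Q F x n)"
      proof
        fix f assume f: "f \<in> space \<nu>"
        have "x \<in> (if f (rep F) then U f else V f)" "openin X (if f (rep F) then U f else V f)"
          using UV(1,2) UV(4,5)[OF F, of f] x by auto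
        then obtain n where "N x n \<subseteq> (if f (rep F) then U f else V f)" using N(3) xX by blast
        then have "f \<in> Q F x n" using f \<nu>(1) by (auto simp: Q_def \<Omega>_def)
        then show "f \<in> (\<Union>n. Q F x n)" by blast
      qed
    qed (auto simp: Q_def \<Omega>_def \<nu>(1))
    \<comment> \<open>Measurability holds because \<nu> measures every subset; the separations are
      chosen without any regularity in \<open>f\<close>.\<close>
    moreover have "range (Q F x) \<subseteq> events" by (intro image_subsetI sets) (simp add: Q_def)
    ultimately have "(\<lambda>n. prob (Q F x n)) \<longlonglongrightarrow> 1"
      using finite_Lim_measure_incseq[of "Q F x"] prob_space by simp
    then have "\<forall>\<^sub>F n in sequentially. prob (Q F x n) > 7/8"
      by (rule order_tendstoD) simp
    then show ?thesis by (rule eventually_happens'[rotated]) simp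
  qed
  then obtain k where k: "\<And>F x. F \<in> \<F> \<Longrightarrow> x \<in> F \<Longrightarrow> prob (Q F x (k F x)) > 7/8" by metis
  define O' where "O' = (\<lambda>F. \<Union>x\<in>F. N x (k F x))"
  show thesis
  proof (rule that)
    show "openin X (O' F) \<and> F \<subseteq> O' F" if "F \<in> \<F>" for F
      using N(2) FX[OF that] unfolding O'_def by (blast intro: openin_Union)
    show "disjnt (O' F) (O' G)" if FG: "F \<in> \<F>" "G \<in> \<F>" "F \<noteq> G" for F G
    proof -
      have "disjnt (N x (k F x)) (N y (k G y))" if xy: "x \<in> F" "y \<in> G" for x y
      proof -
        \<comment> \<open>Two coins showing a prescribed pattern have probability 1/4, while each of
          the two points loses less than 1/8, so some \<open>f\<close> in \<open>D\<close> is good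
          for both.\<close>
        define D where "D = {f \<in> \<Omega>. f (rep F) \<and> \<not> f (rep G)}"
        have ij: "rep F \<in> K" "rep G \<in> K" "rep F \<noteq> rep G" using FG rep_inj by (auto simp: K_def)
        have "emeasure \<nu> D = ennreal (1/4)"
          using \<nu>(3) coin_product_differ[OF ij] by (simp add: D_def \<Omega>_def)
        then have D: "prob D = 1/4" by (simp add: measure_def)
        have ev: "D \<in> events" "Q F x (k F x) \<in> events" "Q G y (k G y) \<in> events"
          by (auto intro!: sets simp: D_def Q_def)
        have "D \<inter> Q F x (k F x) \<inter> Q G y (k G y) \<noteq> {}"
        proof
          assume "D \<inter> Q F x (k F x) \<inter> Q G y (k G y) = {}"
          then have "D \<subseteq> (space \<nu> - Q F x (k F x)) \<union> (space \<nu> - Q G y (k G y))"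
            using sets.sets_into_space[OF ev(1)] by blast
          then have "prob D \<le> prob ((space \<nu> - Q F x (k F x)) \<union> (space \<nu> - Q G y (k G y)))"
            using ev by (intro finite_measure_mono) auto
          also have "\<dots> \<le> prob (space \<nu> - Q F x (k F x)) + prob (space \<nu> - Q G y (k G y))"
            using ev by (intro measure_Un_le) auto
          also have "\<dots> < 1/4"
            using ev k[OF FG(1) xy(1)] k[OF FG(2) xy(2)] by (simp add: prob_compl)
          finally show False using D by simp
        qed
        then obtain f where "f \<in> D" "f \<in> Q F x (k F x)" "f \<in> Q G y (k G y)" by blast
        then have "N x (k F x) \<subseteq> U f" "N y (k G y) \<subseteq> V f"
          by (auto simp: D_def Q_def)
        then show ?thesis using UV(3) disjnt_subset1 disjnt_subset2 by metis
      qed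
      then show ?thesis by (auto simp: O'_def disjnt_iff)
    qed
  qed
qed

section \<open>A \<sigma>-disjoint base of cozero-sets under PMEA\<close>

lemma PMEA_E_space:
  fixes X :: "'a topology"
  assumes PMEA: "PMEA TYPE('a)" and normal: "normal_space X" and t1: "t1_space X"
    and ub: "has_uniform_base X"
  shows "E_space X"
proof -
  obtain \<B> where "uniform_base_in X \<B>" using ub by (auto simp: has_uniform_base_def)
  then interpret t1_uniform_base X \<B> using t1 by unfold_locales
  have "\<exists>C. (\<forall>j::nat. closedin X (C j)) \<and> (\<Union>j. C j) = {x \<in> topspace X. card (members n x) = k}" for n k
    using fsigma_in_card_members[of n k] unfolding fsigma_in_ascending by blast
  then obtain C :: "nat \<Rightarrow> nat \<Rightarrow> nat \<Rightarrow> 'a set" where C: "\<And>n k j. closedin X (C n k j)"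
    "\<And>n k. (\<Union>j. C n k j) = {x \<in> topspace X. card (members n x) = k}"
    by metis
  have C_card: "card (members n x) = k" if "x \<in> C n k j" for n k j x
    using C(2)[of n k] that by blast
  define cls where "cls = (\<lambda>n k j T. {x \<in> C n k j. members n x = T})"
  define \<F> where "\<F> = (\<lambda>n k j. range (cls n k j) - {{}})"
  have "discrete_closed_family X (\<F> n k j)" for n k j
    unfolding discrete_closed_family_def
  proof (intro conjI allI impI)
    show "pairwise disjnt (\<F> n k j)"
      by (auto simp: pairwise_def disjnt_def \<F>_def cls_def)
    fix \<G> assume \<G>: "\<G> \<subseteq> \<F> n k j"
    have "\<Union>\<G> = {x \<in> C n k j. members n x \<in> {T. cls n k j T \<in> \<G>}}"
    proof (intro equalityI subsetI)
      fix x assume "x \<in> \<Union>\<G>"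
      then obtain T where "cls n k j T \<in> \<G>" "x \<in> cls n k j T" using \<G> by (fastforce simp: \<F>_def)
      then show "x \<in> {x \<in> C n k j. members n x \<in> {T. cls n k j T \<in> \<G>}}" by (auto simp: cls_def)
    next
      fix x assume "x \<in> {x \<in> C n k j. members n x \<in> {T. cls n k j T \<in> \<G>}}"
      then have "x \<in> cls n k j (members n x)" "cls n k j (members n x) \<in> \<G>" by (auto simp: cls_def)
      then show "x \<in> \<Union>\<G>" by blast
    qed
    then show "closedin X (\<Union>\<G>)"
      using closedin_Union_members_classes[OF C(1)[of n k j], of n k "{T. cls n k j T \<in> \<G>}"] C_card by simp
  qed
  moreover have "{} \<notin> \<F> n k j" for n k j by (simp add: \<F>_def)
  ultimately have "\<exists>O'. (\<forall>F\<in>\<F> n k j. openin X (O' F) \<and> F \<subseteq> O' F) \<and>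
      (\<forall>F\<in>\<F> n k j. \<forall>G\<in>\<F> n k j. F \<noteq> G \<longrightarrow> disjnt (O' F) (O' G))" for n k j
    using PMEA_separates_discrete_family[OF PMEA normal first_countable, of "\<F> n k j"] by metis
  then obtain O' where O': "\<And>n k j F. F \<in> \<F> n k j \<Longrightarrow> openin X (O' n k j F) \<and> F \<subseteq> O' n k j F"
    "\<And>n k j F G. F \<in> \<F> n k j \<Longrightarrow> G \<in> \<F> n k j \<Longrightarrow> F \<noteq> G \<Longrightarrow> disjnt (O' n k j F) (O' n k j G)"
    by metis
  \<comment> \<open>All points of \<open>F\<close> have the same members, so the second factor is a
    finite intersection of these with the space: it is open and lies inside each of them.\<close>
  define V where "V = (\<lambda>n k j F. O' n k j F \<inter> {y \<in> topspace X. \<forall>x\<in>F. members n x \<subseteq> members n y})"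
  \<comment> \<open>Countably many disjoint families: one for every triple \<open>(n, k, j)\<close>,
    and one more, at \<open>None\<close>, for the isolated points.\<close>
  define A where "A = (\<lambda>m. case (from_nat m :: (nat \<times> nat \<times> nat) option) of
    None \<Rightarrow> (\<lambda>x. {x}) ` isolated | Some (n, k, j) \<Rightarrow> V n k j ` \<F> n k j)"
  define \<alpha> where "\<alpha> = (\<Union>m. A m)"
  have A_sing: "A (to_nat (None :: (nat \<times> nat \<times> nat) option)) = (\<lambda>x. {x}) ` isolated"
    and A_V: "A (to_nat (Some (n, k, j))) = V n k j ` \<F> n k j" for n k j
    by (simp_all add: A_def)
  have "strongly_point_finite (A m)" for m
  proof (rule strongly_point_finite_disjoint)
    show "pairwise disjnt (A m)"
      using O'(2) unfolding A_def V_def pairwise_def disjnt_def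
      by (auto split: option.splits) blast+
  qed
  then have \<sigma>: "sigma_strongly_point_finite \<alpha>"
    unfolding sigma_strongly_point_finite_def \<alpha>_def by blast
  have openV: "openin X (V n k j F)" if F: "F \<in> \<F> n k j" for n k j F
  proof -
    obtain T where T: "F = cls n k j T" "F \<noteq> {}" using F by (auto simp: \<F>_def)
    then obtain x where x: "x \<in> F" by blast
    have "{y \<in> topspace X. \<forall>x\<in>F. members n x \<subseteq> members n y} = {y \<in> topspace X. members n x \<subseteq> members n y}"
      using x unfolding T(1) by (auto simp: cls_def)
    moreover have "x \<in> topspace X"
      using x C(1) closedin_subset unfolding T(1) cls_def by blast
    ultimately show ?thesis
      using O'(1)[OF F] openin_members_supset[of x n] by (simp add: V_def openin_Int)
  qed
  have open\<alpha>: "openin X W" if "W \<in> \<alpha>" for W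
    using that openV unfolding \<alpha>_def A_def by (auto simp: isolated_def split: option.splits)
  have nbhd: "\<exists>W'\<in>\<alpha>. x \<in> W' \<and> W' \<subseteq> W" if W: "openin X W" "x \<in> W" for x W
  proof (cases "x \<in> isolated")
    case True
    then have "{x} \<in> \<alpha>" using A_sing unfolding \<alpha>_def by blast
    then show ?thesis using W by blast
  next
    case False
    then obtain B where B: "B \<in> \<B>\<^sub>2" "x \<in> B" "B \<subseteq> W" using \<B>\<^sub>2_nbhd[OF W] by blast
    \<comment> \<open>This level makes \<open>B\<close> one of the members at \<open>x\<close>,
      which forces the set \<open>V n k j F\<close> into \<open>B\<close>.\<close>
    define n where "n = rank B"
    define k where "k = card (members n x)"
    have x: "x \<in> topspace X" using W openin_subset by blast
    then obtain j where j: "x \<in> C n k j" using C(2)[of n k] by (auto simp: k_def)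
    define F where "F = cls n k j (members n x)"
    have xF: "x \<in> F" using j by (simp add: F_def cls_def)
    then have F: "F \<in> \<F> n k j" by (auto simp: \<F>_def F_def)
    have "B \<in> members n x" using B by (simp add: members_def n_def)
    then have "V n k j F \<subseteq> B"
      using xF by (auto simp: V_def members_def)
    moreover have "x \<in> V n k j F"
      using xF x O'(1)[OF F] by (auto simp: V_def F_def cls_def)
    moreover have "V n k j F \<in> \<alpha>"
      using F A_V unfolding \<alpha>_def by blast
    ultimately show ?thesis using B(3) by blast
  qed
  have "openin X W \<longleftrightarrow> (arbitrary union_of (\<lambda>W. W \<in> \<alpha>)) W" for W
  proof
    show "openin X W \<Longrightarrow> (arbitrary union_of (\<lambda>W. W \<in> \<alpha>)) W"
      using nbhd unfolding arbitrary_union_of_alt by blast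
    show "(arbitrary union_of (\<lambda>W. W \<in> \<alpha>)) W \<Longrightarrow> openin X W"
      using open\<alpha> unfolding union_of_def by blast
  qed
  then have "base_in X \<alpha>" by (auto simp: base_in_def)
  moreover have "cozero_set_in X W" if "W \<in> \<alpha>" for W
    using cozero_set_in_normal_fsigma[OF normal] open\<alpha>[OF that] fsigma_in_openin by blast
  ultimately show ?thesis
    using E_space_if_cozero_base t1 t1_imp_t0_space \<sigma> by blast
qed

theorem mainTheorem8:
  shows "(Tychonoff_space pixley_roy \<and> has_uniform_base pixley_roy \<and> \<not> E_space pixley_roy) \<and>
    (martins_axiom TYPE(real set) \<and> \<not> continuum_hypothesis \<longrightarrow>
       (\<exists>X :: real set topology.
          normal_space X \<and> Hausdorff_space X \<and> has_uniform_base X \<and> \<not> E_space X)) \<and>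
    (PMEA TYPE('a) \<longrightarrow>
       (\<forall>X :: 'a topology.
          normal_space X \<and> t1_space X \<and> has_uniform_base X \<longrightarrow> E_space X))"
proof (intro conjI impI allI)
  have "uncountable (UNIV :: real set)"
    by (rule uncountable_UNIV_real)
  then show "\<not> E_space pixley_roy"
    using not_E_space_PR[of UNIV] by (simp add: PR_UNIV)
  show "Tychonoff_space pixley_roy" "has_uniform_base pixley_roy"
    using Tychonoff_PR[of UNIV] has_uniform_base_PR[of UNIV] by (simp_all add: PR_UNIV)
next
  assume "martins_axiom TYPE(real set) \<and> \<not> continuum_hypothesis"
  then show "\<exists>X :: real set topology. normal_space X \<and> Hausdorff_space X \<and> has_uniform_base X \<and> \<not> E_space X"
    using normal_PR_not_E_space by blast
next
  fix X :: "'a topology"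
  assume "PMEA TYPE('a)" "normal_space X \<and> t1_space X \<and> has_uniform_base X"
  then show "E_space X"
    using PMEA_E_space by blast
qed

end
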